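(* Let $B=M_2$ be the metric space of systems $$\dot x=A(t)x,\quad x\in\mathbb{R}^2,\qquad A(t)=\begin{pmatrix} 0 & 1 \\ a(t) & 0 \end{pmatrix},$$ equivalent to differential equations $\ddot y=a(t)y$, where $a:\mathbb{R}\to\mathbb{R}$ is continuous with $\sup_{t\in\mathbb{R}}|a(t)|<\infty$. Let $E=B\times\mathbb{R}^2$ and let $p=\mathrm{pr}_1:E\to B$ be the projection onto the first factor. For $t\in\mathbb{R}$ define $$X^t(A,x)=(\chi^tA,\ \mathfrak{X}(t,0,A)x),\qquad \chi^tA(\cdot)=A(t+(\cdot)),\qquad A\in B,\ x\in\mathbb{R}^2,$$ where $\mathfrak{X}(\theta,\tau,A)$ is the Cauchy matrix of $\dot x=A(t)x$. Then the family of morphisms $(X(m),\chi(m))=(X^m,\chi^m):(E,p,B)\to(E,p,B)$, $m\in\mathbb{N}$, of the vector bundle $(E,p,B)$ is not saturated.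
   Context: The metric on $M_2$ is $d(A_1,A_2)=\sup_{t\in\mathbb{R}}\|A_1(t)-A_2(t)\|$. The Cauchy matrix $\mathfrak{X}(\theta,\tau,A)$ is the matrix with $\frac{\partial}{\partial\theta}\mathfrak{X}(\theta,\tau,A)=A(\theta)\mathfrak{X}(\theta,\tau,A)$ and $\mathfrak{X}(\tau,\tau,A)=I$. The bundle $E=B\times\mathbb{R}^2$ is trivial. It carries the product topology, and each fibre $p^{-1}(b)=\{b\}\times\mathbb{R}^2$ has the standard Euclidean structure of $\mathbb{R}^2$. Norms of linear maps between fibres are operator norms. $X=X^1$, $\chi=\chi^1$, and $X[b]:p^{-1}(b)\to p^{-1}(\chi b)$ is the restriction of $X$ to the fibre over $b$. In formulas below $I$ denotes the identity operator of a fibre. Saturated family. Let $(E,p,B)$ be a vector bundle with fibre $\mathbb{R}^n$ over a complete metric space $(B,d_B)$, with a Riemannian metric (a Euclidean structure on the fibres). Consider a family of morphisms $(X(m),\chi(m)):(E,p,B)\to(E,p,B)$, $m\in\mathbb{N}$, such that: (a) $(X,\chi)=(X(1),\chi(1))$ is an isomorphism of the vector bundle $(E,p,B)$; (b) $X(m)=X^m$ and $\chi(m)=\chi^m$ for all $m\in\mathbb{N}$; (c) there is a function $a:B\to\mathbb{R}^+$ with $a(\chi^mb)=a(b)$ for all $b\in B$, $m\in\mathbb{Z}$, and $\max(\|X[b]\|,\|X[b]^{-1}\|)\le e^{a(b)}$ for all $b\in B$. The family is called saturated if for every $b\in B$ with $\chi^mb\ne b$ for all integers $m\neq0$, every $\varepsilon>0$,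 every basis $\{\xi_1,\dots,\xi_n\}$ of $p^{-1}(b)$, and all neighbourhoods $U(\xi_i)$ of the points $\xi_i$ in $E$ ($i=1,\dots,n$), there exists $\delta>0$ such that for every $\overline t\in\mathbb{N}$ and all nonsingular linear operators $Y_m:p^{-1}(\chi^{m-1}b)\to p^{-1}(\chi^mb)$, $m\in\{1,\dots,\overline t\}$, satisfying $$\|Y_m(X[\chi^{m-1}b])^{-1}-I\|+\|X[\chi^{m-1}b]\,Y_m^{-1}-I\|<\delta\quad\text{for all } m\in\{1,\dots,\overline t\},$$ there exist a point $b'\in B$ with $d_B(b',b)<\varepsilon$ and, for each $m\in\{0,\dots,\overline t\}$, an isomorphism of Euclidean spaces (linear isometry) $\psi_m:p^{-1}(\chi^mb')\to p^{-1}(\chi^mb)$, such that: (i) $\psi_0^{-1}\xi_i\in U(\xi_i)$ for all $i\in\{1,\dots,n\}$; (ii) $\psi_m\circ X[\chi^{m-1}b']=Y_m\circ\psi_{m-1}$ for all $m\in\{1,\dots,\overline t\}$. *)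

theory Defs
  imports "HOL-Analysis.Analysis"
begin

text \<open>
  Vector bundles are given by a total space (a topology on a type \<open>'e\<close>), a projection, a metric
  base space with carrier \<open>base\<close> and distance \<open>bdist\<close>, and fibrewise operations.
  The values of \<open>fadd\<close> and \<open>finner\<close> matter only at two points of the same fibre.
\<close>

record ('e, 'b) vbundle =
  total_space :: "'e topology"
  proj :: "'e \<Rightarrow> 'b"
  base :: "'b set"
  bdist :: "'b \<Rightarrow> 'b \<Rightarrow> real"
  fadd :: "'e \<Rightarrow> 'e \<Rightarrow> 'e"
  fscale :: "real \<Rightarrow> 'e \<Rightarrow> 'e"
  finner :: "'e \<Rightarrow> 'e \<Rightarrow> real"

definition base_top :: "('e, 'b) vbundle \<Rightarrow> 'b topology" where
  "base_top \<eta> = Metric_space.mtopology (base \<eta>) (bdist \<eta>)"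

definition fibre :: "('e, 'b) vbundle \<Rightarrow> 'b \<Rightarrow> 'e set" where
  "fibre \<eta> b = {e \<in> topspace (total_space \<eta>). proj \<eta> e = b}"

definition fnorm :: "('e, 'b) vbundle \<Rightarrow> 'e \<Rightarrow> real" where
  "fnorm \<eta> e = sqrt (finner \<eta> e e)"

definition fminus :: "('e, 'b) vbundle \<Rightarrow> 'e \<Rightarrow> 'e \<Rightarrow> 'e" where
  "fminus \<eta> u v = fadd \<eta> u (fscale \<eta> (-1) v)"

text \<open>
  In the local trivialization \<open>e \<mapsto> (proj e, \<phi> e)\<close> the map \<open>\<phi>\<close> carries the operations of each fibre
  bijectively to those of \<open>\<real>\<^sup>n\<close>; this entails the vector space axioms for the fibres.
  The type argument is the index type of the model fibre \<open>\<real>\<^sup>n\<close>.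
\<close>

definition vector_bundle :: "'n::finite itself \<Rightarrow> ('e, 'b) vbundle \<Rightarrow> bool" where
  "vector_bundle N \<eta> \<longleftrightarrow>
     Metric_space (base \<eta>) (bdist \<eta>) \<and>
     continuous_map (total_space \<eta>) (base_top \<eta>) (proj \<eta>) \<and>
     (\<forall>b\<in>base \<eta>. \<forall>e\<in>fibre \<eta> b. (\<forall>e'\<in>fibre \<eta> b. fadd \<eta> e e' \<in> fibre \<eta> b) \<and>
        (\<forall>c. fscale \<eta> c e \<in> fibre \<eta> b)) \<and>
     (\<forall>b\<in>base \<eta>. \<exists>U (\<phi> :: 'e \<Rightarrow> real ^ 'n). openin (base_top \<eta>) U \<and> b \<in> U \<and>
        homeomorphic_map
          (subtopology (total_space \<eta>) {e \<in> topspace (total_space \<eta>). proj \<eta> e \<in> U})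
          (prod_topology (subtopology (base_top \<eta>) U) euclidean)
          (\<lambda>e. (proj \<eta> e, \<phi> e)) \<and>
        (\<forall>u\<in>U. \<forall>e\<in>fibre \<eta> u.
           (\<forall>e'\<in>fibre \<eta> u. \<phi> (fadd \<eta> e e') = \<phi> e + \<phi> e') \<and>
           (\<forall>c. \<phi> (fscale \<eta> c e) = c *\<^sub>R \<phi> e)))"

text \<open>
  \<open>fscale \<eta> 0 e\<close> is the zero vector of the fibre through \<open>e\<close>.
\<close>

definition riemannian_metric :: "('e, 'b) vbundle \<Rightarrow> bool" where
  "riemannian_metric \<eta> \<longleftrightarrow>
     (\<forall>b\<in>base \<eta>. \<forall>u\<in>fibre \<eta> b.
        (\<forall>v\<in>fibre \<eta> b. finner \<eta> u v = finner \<eta> v u \<and>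
           (\<forall>w\<in>fibre \<eta> b. finner \<eta> (fadd \<eta> u v) w = finner \<eta> u w + finner \<eta> v w) \<and>
           (\<forall>c. finner \<eta> (fscale \<eta> c u) v = c * finner \<eta> u v)) \<and>
        (u \<noteq> fscale \<eta> 0 u \<longrightarrow> finner \<eta> u u > 0)) \<and>
     continuous_map
       (subtopology (prod_topology (total_space \<eta>) (total_space \<eta>)) {(u, v). proj \<eta> u = proj \<eta> v})
       euclideanreal (\<lambda>(u, v). finner \<eta> u v)"

definition fibre_linear :: "('e, 'b) vbundle \<Rightarrow> 'b \<Rightarrow> 'b \<Rightarrow> ('e \<Rightarrow> 'e) \<Rightarrow> bool" where
  "fibre_linear \<eta> b b' L \<longleftrightarrow> L ` fibre \<eta> b \<subseteq> fibre \<eta> b' \<and>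
     (\<forall>u\<in>fibre \<eta> b. (\<forall>v\<in>fibre \<eta> b. L (fadd \<eta> u v) = fadd \<eta> (L u) (L v)) \<and>
        (\<forall>c. L (fscale \<eta> c u) = fscale \<eta> c (L u)))"

definition fibre_iso :: "('e, 'b) vbundle \<Rightarrow> 'b \<Rightarrow> 'b \<Rightarrow> ('e \<Rightarrow> 'e) \<Rightarrow> bool" where
  "fibre_iso \<eta> b b' L \<longleftrightarrow> fibre_linear \<eta> b b' L \<and> bij_betw L (fibre \<eta> b) (fibre \<eta> b')"

definition fibre_isometry :: "('e, 'b) vbundle \<Rightarrow> 'b \<Rightarrow> 'b \<Rightarrow> ('e \<Rightarrow> 'e) \<Rightarrow> bool" where
  "fibre_isometry \<eta> b b' L \<longleftrightarrow> fibre_iso \<eta> b b' L \<and>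
     (\<forall>u\<in>fibre \<eta> b. \<forall>v\<in>fibre \<eta> b. finner \<eta> (L u) (L v) = finner \<eta> u v)"

definition fonorm :: "('e, 'b) vbundle \<Rightarrow> 'b \<Rightarrow> ('e \<Rightarrow> 'e) \<Rightarrow> real" where
  "fonorm \<eta> b L = (SUP u\<in>{u \<in> fibre \<eta> b. fnorm \<eta> u \<le> 1}. fnorm \<eta> (L u))"

definition fspan :: "('e, 'b) vbundle \<Rightarrow> 'b \<Rightarrow> 'e set \<Rightarrow> 'e set" where
  "fspan \<eta> b S = \<Inter>{W. S \<subseteq> W \<and> W \<subseteq> fibre \<eta> b \<and> W \<noteq> {} \<and>
     (\<forall>u\<in>W. (\<forall>v\<in>W. fadd \<eta> u v \<in> W) \<and> (\<forall>c. fscale \<eta> c u \<in> W))}"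

definition fibre_basis :: "('e, 'b) vbundle \<Rightarrow> 'b \<Rightarrow> ('n::finite \<Rightarrow> 'e) \<Rightarrow> bool" where
  "fibre_basis \<eta> b \<xi> \<longleftrightarrow> range \<xi> \<subseteq> fibre \<eta> b \<and>
     (\<forall>i. \<xi> i \<notin> fspan \<eta> b (\<xi> ` (- {i}))) \<and> fspan \<eta> b (range \<xi>) = fibre \<eta> b"

definition bundle_morphism :: "('e, 'b) vbundle \<Rightarrow> ('e \<Rightarrow> 'e) \<Rightarrow> ('b \<Rightarrow> 'b) \<Rightarrow> bool" where
  "bundle_morphism \<eta> F f \<longleftrightarrow>
     continuous_map (total_space \<eta>) (total_space \<eta>) F \<and> continuous_map (base_top \<eta>) (base_top \<eta>) f \<and>
     (\<forall>b\<in>base \<eta>. fibre_linear \<eta> b (f b) F)"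

definition bundle_isomorphism :: "('e, 'b) vbundle \<Rightarrow> ('e \<Rightarrow> 'e) \<Rightarrow> ('b \<Rightarrow> 'b) \<Rightarrow> bool" where
  "bundle_isomorphism \<eta> F f \<longleftrightarrow> bundle_morphism \<eta> F f \<and>
     (\<exists>G g. bundle_morphism \<eta> G g \<and>
        (\<forall>e\<in>topspace (total_space \<eta>). G (F e) = e \<and> F (G e) = e) \<and>
        (\<forall>b\<in>base \<eta>. g (f b) = b \<and> f (g b) = b))"

text \<open>
  Integer iterates of a self-bijection \<open>f\<close> of the set \<open>S\<close>.
\<close>

definition int_iterate :: "'a set \<Rightarrow> ('a \<Rightarrow> 'a) \<Rightarrow> int \<Rightarrow> 'a \<Rightarrow> 'a" where
  "int_iterate S f m = (if m \<ge> 0 then f ^^ nat m else inv_into S f ^^ nat (- m))"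

text \<open>
  The standing assumptions under which saturation is considered.
\<close>

definition morphism_family ::
    "('e, 'b) vbundle \<Rightarrow> (nat \<Rightarrow> 'e \<Rightarrow> 'e) \<Rightarrow> (nat \<Rightarrow> 'b \<Rightarrow> 'b) \<Rightarrow> bool" where
  "morphism_family \<eta> X h \<longleftrightarrow>
     (\<forall>m. bundle_morphism \<eta> (X m) (h m)) \<and>
     bundle_isomorphism \<eta> (X 1) (h 1) \<and>
     (\<forall>m. (\<forall>e\<in>topspace (total_space \<eta>). X m e = (X 1 ^^ m) e) \<and>
          (\<forall>b\<in>base \<eta>. h m b = (h 1 ^^ m) b)) \<and>
     (\<exists>a :: 'b \<Rightarrow> real. \<forall>b\<in>base \<eta>. a b > 0 \<and>
        (\<forall>m. a (int_iterate (base \<eta>) (h 1) m b) = a b) \<and>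
        max (fonorm \<eta> b (X 1)) (fonorm \<eta> (h 1 b) (inv_into (fibre \<eta> b) (X 1))) \<le> exp (a b))"

definition saturated ::
    "'n::finite itself \<Rightarrow> ('e, 'b) vbundle \<Rightarrow> (nat \<Rightarrow> 'e \<Rightarrow> 'e) \<Rightarrow> (nat \<Rightarrow> 'b \<Rightarrow> 'b) \<Rightarrow> bool" where
  "saturated N \<eta> X h \<longleftrightarrow>
     (\<forall>b\<in>base \<eta>. (\<forall>m. m \<noteq> 0 \<longrightarrow> int_iterate (base \<eta>) (h 1) m b \<noteq> b) \<longrightarrow>
       (\<forall>\<epsilon>>0. \<forall>\<xi> :: 'n \<Rightarrow> 'e. fibre_basis \<eta> b \<xi> \<longrightarrow>
         (\<forall>U. (\<forall>i. \<exists>V. openin (total_space \<eta>) V \<and> \<xi> i \<in> V \<and> V \<subseteq> U i) \<longrightarrow>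
           (\<exists>\<delta>>0. \<forall>T :: nat. \<forall>Y.
              (\<forall>m\<in>{1..T}. fibre_iso \<eta> (h (m - 1) b) (h m b) (Y m)) \<and>
              (\<forall>m\<in>{1..T}.
                 fonorm \<eta> (h m b)
                   (\<lambda>v. fminus \<eta> (Y m (inv_into (fibre \<eta> (h (m - 1) b)) (X 1) v)) v) +
                 fonorm \<eta> (h m b)
                   (\<lambda>v. fminus \<eta> (X 1 (inv_into (fibre \<eta> (h (m - 1) b)) (Y m) v)) v) < \<delta>) \<longrightarrow>
              (\<exists>b'\<in>base \<eta>. bdist \<eta> b' b < \<epsilon> \<and>
                (\<exists>\<psi>. (\<forall>m\<in>{0..T}. fibre_isometry \<eta> (h m b') (h m b) (\<psi> m)) \<and>
                  (\<forall>i. inv_into (fibre \<eta> b') (\<psi> 0) (\<xi> i) \<in> U i) \<and>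
                  (\<forall>m\<in>{1..T}. \<forall>e\<in>fibre \<eta> (h (m - 1) b').
                     \<psi> m (X 1 e) = Y m (\<psi> (m - 1) e))))))))"

definition product_bundle ::
    "'b set \<Rightarrow> ('b \<Rightarrow> 'b \<Rightarrow> real) \<Rightarrow> ('b \<times> (real ^ 'n::finite), 'b) vbundle" where
  "product_bundle B d =
     \<lparr>total_space = prod_topology (Metric_space.mtopology B d) euclidean,
      proj = fst, base = B, bdist = d,
      fadd = (\<lambda>(b, x) (c, y). (b, x + y)),
      fscale = (\<lambda>r (b, x). (b, r *\<^sub>R x)),
      finner = (\<lambda>(b, x) (c, y). x \<bullet> y)\<rparr>"

definition cauchy_matrix :: "real \<Rightarrow> real \<Rightarrow> (real \<Rightarrow> real ^ 'n ^ 'n) \<Rightarrow> real ^ 'n::finite ^ 'n" where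
  "cauchy_matrix \<theta> \<tau> A =
     (THE \<Phi>. (\<forall>s. (\<Phi> has_vector_derivative A s ** \<Phi> s) (at s)) \<and> \<Phi> \<tau> = mat 1) \<theta>"

definition M2 :: "(real \<Rightarrow> real ^ 2 ^ 2) set" where
  "M2 = {A. \<exists>a :: real \<Rightarrow> real. continuous_on UNIV a \<and> bounded (range a) \<and>
            A = (\<lambda>t. vector [vector [0, 1], vector [a t, 0]])}"

text \<open>
  \<open>Metric_space\<close> demands nonnegativity and symmetry outside the carrier as well, where the
  supremum may be unspecified; hence the default value.
\<close>

definition sup_dist :: "(real \<Rightarrow> real ^ 2 ^ 2) \<Rightarrow> (real \<Rightarrow> real ^ 2 ^ 2) \<Rightarrow> real" where
  "sup_dist A\<^sub>1 A\<^sub>2 =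
     (if A\<^sub>1 \<in> M2 \<and> A\<^sub>2 \<in> M2 then SUP t. onorm (\<lambda>x. (A\<^sub>1 t - A\<^sub>2 t) *v x) else 0)"

definition M2_bundle :: "((real \<Rightarrow> real ^ 2 ^ 2) \<times> (real ^ 2), real \<Rightarrow> real ^ 2 ^ 2) vbundle" where
  "M2_bundle = product_bundle M2 sup_dist"

definition shift :: "real \<Rightarrow> (real \<Rightarrow> real ^ 2 ^ 2) \<Rightarrow> real \<Rightarrow> real ^ 2 ^ 2" where
  "shift t A = (\<lambda>s. A (t + s))"

definition flow ::
    "real \<Rightarrow> (real \<Rightarrow> real ^ 2 ^ 2) \<times> (real ^ 2) \<Rightarrow> (real \<Rightarrow> real ^ 2 ^ 2) \<times> (real ^ 2)" where
  "flow t = (\<lambda>(A, x). (shift t A, cauchy_matrix t 0 A *v x))"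

end

theory Submission
  imports Defs
begin

text \<open>
  The matrices of \<open>M2\<close> have trace zero, so by Liouville's formula every Cauchy matrix has
  determinant 1. If isometries \<open>\<psi>\<^sub>0\<close>, \<open>\<psi>\<^sub>1\<close> satisfy \<open>\<psi>\<^sub>1 \<circ> X[b'] = Y \<circ> \<psi>\<^sub>0\<close>, then \<open>\<bar>det Y\<bar> = 1\<close>. Hence
  for any non-periodic \<open>b\<close> (such as \<open>a = arctan\<close>) the perturbation \<open>Y = (1 + \<eta>) X[b]\<close>, which is
  arbitrarily close to \<open>X[b]\<close> and has determinant \<open>(1 + \<eta>)\<^sup>2\<close>, contradicts saturation already for
  one time step.

  Bounds for solutions, their uniqueness and their continuous dependence on the coefficients all
  come from one energy estimate: if \<open>\<parallel>y'\<parallel> \<le> M \<parallel>y\<parallel> + \<epsilon>\<close>, then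
  \<open>(\<parallel>y\<parallel>\<^sup>2)' \<le> (2 M + 1) \<parallel>y\<parallel>\<^sup>2 + \<epsilon>\<^sup>2\<close>.
\<close>

section \<open>Linear differential equations\<close>

lemma has_vector_derivative_reflect:
  assumes "(f has_vector_derivative f') (at (- s))"
  shows "((\<lambda>s. f (- s)) has_vector_derivative - f') (at s)"
proof -
  have "(uminus has_vector_derivative (-1 :: real)) (at s)"
    by (auto intro!: derivative_eq_intros)
  from vector_diff_chain_at[OF this, of f f'] assms show ?thesis by (simp add: o_def)
qed

text \<open>Mean value inequality against \<open>C * s ^ Suc n / Suc n\<close>, whose derivative is
  the given bound. It is the induction step for the Picard terms.\<close>

lemma antiderivative_power_bound_pos:
  fixes G :: "real \<Rightarrow> 'a::real_normed_vector"
  assumes "G 0 = 0" and der: "\<And>t. (G has_vector_derivative g t) (at t)"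
    and bd: "\<And>t. norm (g t) \<le> C * \<bar>t\<bar> ^ n" and "t \<ge> 0"
  shows "norm (G t) \<le> C * t ^ Suc n / Suc n"
\<comment> \<open>The mean value inequality requires a nondegenerate interval.\<close>
proof (cases "t = 0")
  case False
  have "norm (G t - G 0) \<le> C * t ^ Suc n / Suc n - C * 0 ^ Suc n / Suc n"
  proof (rule differentiable_bound_general)
    show "continuous_on {0..t} G"
      by (meson continuous_at_imp_continuous_on der has_vector_derivative_continuous)
    show "continuous_on {0..t} (\<lambda>s. C * s ^ Suc n / Suc n)"
      by (intro continuous_intros) auto
    show "((\<lambda>s. C * s ^ Suc n / Suc n) has_vector_derivative C * s ^ n) (at s)" for s :: real
      unfolding has_real_derivative_iff_has_vector_derivative[symmetric]
      by (rule derivative_eq_intros | simp)+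
    show "norm (g s) \<le> C * s ^ n" if "0 < s" for s
      using bd[of s] that by simp
  qed (use False \<open>t \<ge> 0\<close> der in auto)
  then show ?thesis using assms(1) by simp
qed (use assms(1) in simp)

text \<open>Negative times follow from positive ones by reflecting time.\<close>

lemma antiderivative_power_bound:
  fixes G :: "real \<Rightarrow> 'a::real_normed_vector"
  assumes "G 0 = 0" and der: "\<And>t. (G has_vector_derivative g t) (at t)"
    and bd: "\<And>t. norm (g t) \<le> C * \<bar>t\<bar> ^ n"
  shows "norm (G t) \<le> C * \<bar>t\<bar> ^ Suc n / Suc n"
proof (cases "t \<ge> 0")
  case True
  then show ?thesis
    using antiderivative_power_bound_pos[OF assms] by simp
next
  case False
  have "((\<lambda>s. G (- s)) has_vector_derivative (- g (- s))) (at s)" for s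
    by (rule has_vector_derivative_reflect[OF der])
  then have "norm (G (- (- t))) \<le> C * (- t) ^ Suc n / Suc n"
    by (rule antiderivative_power_bound_pos[rotated]) (use assms(1) False bd[of "- s" for s] in auto)
  then show ?thesis using False by simp
qed

text \<open>
  The solution is the sum of the Picard series, whose terms \<open>u\<^sub>n\<close> satisfy \<open>u\<^sub>0 = y\<^sub>0\<close>,
  \<open>u\<^bsub>n+1\<^esub>' = A u\<^sub>n\<close> and \<open>u\<^bsub>n+1\<^esub>(0) = 0\<close>.
\<close>

lemma linear_ode_exists:
  fixes A :: "real \<Rightarrow> 'a::euclidean_space \<Rightarrow>\<^sub>L 'a"
  assumes cont: "continuous_on UNIV A" and bd: "\<And>t. norm (A t) \<le> M"
  shows "\<exists>y. y 0 = y0 \<and> (\<forall>t. (y has_vector_derivative A t (y t)) (at t))"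
proof -
  have M0: "M \<ge> 0" using bd[of 0] norm_ge_zero order_trans by blast
  \<comment> \<open>The Picard operator \<open>P\<close>: integrate \<open>A t (g t)\<close> over
    the whole line and normalise the antiderivative to vanish at 0.\<close>
  have "\<exists>F. F 0 = 0 \<and> (\<forall>t. (F has_vector_derivative A t (g t)) (at t))"
    if "continuous_on UNIV g" for g
  proof -
    have "isCont (\<lambda>t. A t (g t)) t" for t
      using cont that by (auto simp: continuous_on_eq_continuous_at intro!: continuous_intros)
    then obtain F where "\<And>t. (F has_vector_derivative A t (g t)) (at t)"
      using einterval_antiderivative[of "-\<infinity>" \<infinity> "\<lambda>t. A t (g t)"] by auto
    then have "((\<lambda>t. F t - F 0) has_vector_derivative A t (g t)) (at t)" for t
      by (auto intro!: derivative_eq_intros)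
    then show ?thesis by (intro exI[of _ "\<lambda>t. F t - F 0"]) auto
  qed
  then obtain P where P0: "\<And>g. continuous_on UNIV g \<Longrightarrow> P g 0 = 0"
    and Pd: "\<And>g t. continuous_on UNIV g \<Longrightarrow> (P g has_vector_derivative A t (g t)) (at t)"
    by metis
  define u where "u n = (P ^^ n) (\<lambda>_. y0)" for n
  have u0: "u 0 = (\<lambda>_. y0)" and uS: "u (Suc n) = P (u n)" for n
    by (auto simp: u_def)
  have Pc: "continuous_on UNIV (P g)" if "continuous_on UNIV g" for g
    using Pd[OF that] by (meson continuous_at_imp_continuous_on has_vector_derivative_continuous)
  have uc: "continuous_on UNIV (u n)" for n
    by (induction n) (auto simp: u0 uS Pc)
  define u' where "u' n t = (case n of 0 \<Rightarrow> 0 | Suc k \<Rightarrow> A t (u k t))" for n t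
  have ud: "(u n has_vector_derivative u' n t) (at t)" for n t
    using Pd[OF uc] by (cases n) (auto simp: u0 uS u'_def)
  \<comment> \<open>Each application of \<open>P\<close> contributes a factor \<open>M\<close> and
    one integration, which raises the power of the absolute value of \<open>t\<close> and divides by
    \<open>n + 1\<close>.\<close>
  have ub: "norm (u n t) \<le> norm y0 * M ^ n / fact n * \<bar>t\<bar> ^ n" for n t
  proof (induction n arbitrary: t)
    case 0 then show ?case by (simp add: u0)
  next
    case (Suc n)
    have "norm (u' (Suc n) t) \<le> norm y0 * M ^ Suc n / fact n * \<bar>t\<bar> ^ n" for t
    proof -
      have "norm (u' (Suc n) t) \<le> norm (A t) * norm (u n t)"
        by (simp add: u'_def norm_blinfun)
      also have "\<dots> \<le> M * (norm y0 * M ^ n / fact n * \<bar>t\<bar> ^ n)"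
        by (intro mult_mono bd Suc.IH M0 norm_ge_zero)
      finally show ?thesis by (simp add: mult_ac)
    qed
    from antiderivative_power_bound[OF _ ud this] show ?case
      by (simp add: uS P0 uc field_simps)
  qed
  define y where "y t = (\<Sum>n. u n t)" for t
  have yd: "(y has_vector_derivative A t (y t)) (at t)" for t
  proof -
    \<comment> \<open>The majorants are uniform only on bounded sets of times. The radius puts
      \<open>t\<close> in the interior of \<open>S\<close>, so the derivative within
      \<open>S\<close> is the derivative at \<open>t\<close>.\<close>
    define R where "R = \<bar>t\<bar> + 1"
    define S where "S = ball (0::real) R"
    have S: "\<bar>s\<bar> \<le> R" if "s \<in> S" for s using that by (simp add: S_def)
    have sume: "summable (\<lambda>n. norm y0 * (M * R) ^ n / fact n)"
      using summable_mult[OF summable_exp[of "M * R"], of "norm y0"] by (simp add: field_simps)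
    have ubS: "norm (u n s) \<le> norm y0 * (M * R) ^ n / fact n" if "s \<in> S" for s n
    proof -
      have "norm (u n s) \<le> norm y0 * M ^ n / fact n * \<bar>s\<bar> ^ n" by (rule ub)
      also have "\<dots> \<le> norm y0 * M ^ n / fact n * R ^ n"
        by (intro mult_left_mono power_mono S that) (auto simp: M0)
      finally show ?thesis by (simp add: power_mult_distrib)
    qed
    have su: "summable (\<lambda>n. u n s)" if "s \<in> S" for s
      by (rule summable_comparison_test'[OF sume]) (use ubS that in auto)
    \<comment> \<open>A summable majorant of the differentiated series: \<open>u' n\<close> is
      \<open>A\<close> applied to the previous term, hence the index shift and the factor
      \<open>M\<close>.\<close>
    define b where "b n = (case n of 0 \<Rightarrow> 0 | Suc k \<Rightarrow> M * (norm y0 * (M * R) ^ k / fact k))" for n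
    have sb: "summable b"
      by (subst summable_Suc_iff[symmetric]) (use summable_mult[OF sume, of M] in \<open>simp add: b_def\<close>)
    have u'b: "norm (u' n s) \<le> b n" if "s \<in> S" for n s
    proof (cases n)
      case (Suc k)
      have "norm (u' n s) \<le> norm (A s) * norm (u k s)"
        by (simp add: u'_def Suc norm_blinfun)
      also have "\<dots> \<le> b n"
        unfolding b_def Suc nat.case by (intro mult_mono bd ubS that M0 norm_ge_zero)
      finally show ?thesis .
    qed (simp add: u'_def b_def)
    have ul: "uniform_limit S (\<lambda>n s. \<Sum>i<n. u' i s) (\<lambda>s. \<Sum>i. u' i s) sequentially"
      by (rule Weierstrass_m_test[OF _ sb]) (use u'b in auto)
    have lim: "(\<Sum>i. u' i s) = A s (y s)" if "s \<in> S" for s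
    proof -
      have "summable (\<lambda>i. u' i s)"
        by (rule summable_comparison_test'[OF sb]) (use u'b that in auto)
      then have "(\<Sum>i. u' i s) = (\<Sum>i. u' (Suc i) s)"
        by (subst suminf_split_head) (auto simp: u'_def)
      also have "\<dots> = A s (y s)"
        unfolding y_def by (simp add: u'_def bounded_linear.suminf[OF blinfun.bounded_linear_right su[OF that]])
      finally show ?thesis .
    qed
    have t: "t \<in> S" by (simp add: S_def R_def)
    \<comment> \<open>Termwise differentiation yields some limit \<open>g\<close>, which uniqueness
      of sums then identifies with \<open>y\<close> on \<open>S\<close>.\<close>
    have "\<exists>g. \<forall>x\<in>S. (\<lambda>n. u n x) sums (g x) \<and>
        (g has_derivative (\<lambda>h. h *\<^sub>R A x (y x))) (at x within S)"
    proof (rule has_derivative_series[where f' = "\<lambda>n x h. h *\<^sub>R u' n x"])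
      show "convex S" by (simp add: S_def)
      show "(u n has_derivative (\<lambda>h. h *\<^sub>R u' n x)) (at x within S)" for n x
        using ud[of n x] by (simp add: has_vector_derivative_def has_derivative_at_withinI)
      show "\<forall>\<^sub>F n in sequentially. \<forall>x\<in>S. \<forall>h.
          norm ((\<Sum>i<n. h *\<^sub>R u' i x) - h *\<^sub>R A x (y x)) \<le> e * norm h" if "e > 0" for e
        using ul[unfolded uniform_limit_iff, rule_format, OF that]
      proof eventually_elim
        case (elim n)
        show ?case
        proof (intro ballI allI)
          fix x h assume x: "x \<in> S"
          have "norm ((\<Sum>i<n. h *\<^sub>R u' i x) - h *\<^sub>R A x (y x)) =
              \<bar>h\<bar> * dist (\<Sum>i<n. u' i x) (\<Sum>i. u' i x)"
            by (simp add: lim[OF x] dist_norm flip: scaleR_sum_right scaleR_diff_right)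
          also have "\<dots> \<le> \<bar>h\<bar> * e"
            using elim x by (intro mult_left_mono) (auto intro: less_imp_le)
          finally show "norm ((\<Sum>i<n. h *\<^sub>R u' i x) - h *\<^sub>R A x (y x)) \<le> e * norm h"
            by (simp add: mult.commute)
        qed
      qed
      show "(\<lambda>n. u n t) sums y t" unfolding y_def by (rule summable_sums[OF su[OF t]])
    qed (rule t)
    then obtain g where g: "\<And>x. x \<in> S \<Longrightarrow> (\<lambda>n. u n x) sums (g x)"
      and gd: "\<And>x. x \<in> S \<Longrightarrow> (g has_derivative (\<lambda>h. h *\<^sub>R A x (y x))) (at x within S)"
      by blast
    have gy: "g x = y x" if "x \<in> S" for x
      using sums_unique[OF g[OF that]] unfolding y_def by simp
    have "open S" by (simp add: S_def)
    then have "(g has_derivative (\<lambda>h. h *\<^sub>R A t (y t))) (at t)"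
      using gd[OF t] at_within_open[OF t] by metis
    from has_derivative_transform_within_open[OF this \<open>open S\<close> t gy] show ?thesis
      unfolding has_vector_derivative_def .
  qed
  have "u n 0 = (if n = 0 then y0 else 0)" for n
    by (cases n) (auto simp: u0 uS P0 uc)
  then have "y 0 = y0"
    unfolding y_def using suminf_finite[of "{0}" "\<lambda>n. u n 0"] by simp
  with yd show ?thesis by blast
qed

text \<open>The squared norm is used because it is differentiable even where \<open>y\<close>
  vanishes. The slack \<open>\<epsilon>\<close> absorbs an inhomogeneous term: it is 0 for
  uniqueness and growth bounds, and measures the perturbation for continuous dependence.\<close>

lemma norm_gronwall_pos:
  fixes y :: "real \<Rightarrow> 'a::real_inner"
  assumes der: "\<And>s. (y has_vector_derivative f s) (at s)" and "M \<ge> 0" "t \<ge> 0"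
    and bd: "\<And>s. \<bar>s\<bar> \<le> t \<Longrightarrow> norm (f s) \<le> M * norm (y s) + \<epsilon>"
  shows "(norm (y t))\<^sup>2 \<le> exp ((2 * M + 1) * t) * ((norm (y 0))\<^sup>2 + \<epsilon>\<^sup>2 * t)"
proof -
  define k where "k = 2 * M + 1"
  \<comment> \<open>\<open>E\<close> is the energy with its admissible growth removed; it decreases on \<open>[0, t]\<close>.\<close>
  define E where "E s = exp (- k * s) * (y s \<bullet> y s) - \<epsilon>\<^sup>2 * s" for s
  have dE: "(E has_real_derivative
      exp (- k * s) * (2 * (y s \<bullet> f s) - k * (y s \<bullet> y s)) - \<epsilon>\<^sup>2) (at s)" for s
  proof -
    have "((\<lambda>s. y s \<bullet> y s) has_real_derivative 2 * (y s \<bullet> f s)) (at s)"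
      using bounded_bilinear.has_vector_derivative[OF bounded_bilinear_inner der der, of s]
      by (simp add: has_real_derivative_iff_has_vector_derivative inner_commute)
    then show ?thesis
      unfolding E_def by (auto intro!: derivative_eq_intros simp: algebra_simps)
  qed
  have "E t \<le> E 0"
  proof (rule DERIV_nonpos_imp_nonincreasing[OF \<open>t \<ge> 0\<close>])
    fix s assume s: "0 \<le> s" "s \<le> t"
    have "2 * (y s \<bullet> f s) \<le> 2 * (norm (y s) * (M * norm (y s) + \<epsilon>))"
      using norm_cauchy_schwarz[of "y s" "f s"] mult_left_mono[OF bd[of s] norm_ge_zero[of "y s"]] s
      by simp
    \<comment> \<open>The mixed term \<open>2 * \<epsilon> * norm (y s)\<close> is split into two
      squares; this is the source of the additional 1 in \<open>k\<close>.\<close>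
    also have "\<dots> \<le> k * (norm (y s))\<^sup>2 + \<epsilon>\<^sup>2"
      using sum_squares_bound[of "norm (y s)" \<epsilon>]
      by (simp add: k_def algebra_simps power2_eq_square)
    finally have "2 * (y s \<bullet> f s) - k * (y s \<bullet> y s) \<le> \<epsilon>\<^sup>2"
      by (simp add: power2_norm_eq_inner)
    then have "exp (- k * s) * (2 * (y s \<bullet> f s) - k * (y s \<bullet> y s)) \<le> exp (- k * s) * \<epsilon>\<^sup>2"
      by (intro mult_left_mono) auto
    also have "\<dots> \<le> 1 * \<epsilon>\<^sup>2"
    proof (intro mult_right_mono)
      have "0 \<le> k * s" using s \<open>M \<ge> 0\<close> by (simp add: k_def)
      then show "exp (- k * s) \<le> 1" by simp
    qed simp
    finally show "\<exists>d. (E has_real_derivative d) (at s) \<and> d \<le> 0"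
      using dE[of s] by auto
  qed
  then have "exp (k * t) * (exp (- k * t) * (norm (y t))\<^sup>2) \<le> exp (k * t) * ((norm (y 0))\<^sup>2 + \<epsilon>\<^sup>2 * t)"
    by (intro mult_left_mono) (auto simp: E_def power2_norm_eq_inner)
  then show ?thesis
    unfolding k_def[symmetric] mult.assoc[symmetric] by (simp flip: exp_add)
qed

lemma norm_gronwall:
  fixes y :: "real \<Rightarrow> 'a::real_inner"
  assumes der: "\<And>s. (y has_vector_derivative f s) (at s)" and "M \<ge> 0"
    and bd: "\<And>s. \<bar>s\<bar> \<le> \<bar>t\<bar> \<Longrightarrow> norm (f s) \<le> M * norm (y s) + \<epsilon>"
  shows "(norm (y t))\<^sup>2 \<le> exp ((2 * M + 1) * \<bar>t\<bar>) * ((norm (y 0))\<^sup>2 + \<epsilon>\<^sup>2 * \<bar>t\<bar>)"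
proof (cases "t \<ge> 0")
  case True
  then show ?thesis using norm_gronwall_pos[OF der \<open>M \<ge> 0\<close> True] bd by simp
next
  case False
  have "(norm (y (- (- t))))\<^sup>2 \<le> exp ((2 * M + 1) * (- t)) * ((norm (y (- 0)))\<^sup>2 + \<epsilon>\<^sup>2 * (- t))"
    by (rule norm_gronwall_pos[OF has_vector_derivative_reflect[OF der] \<open>M \<ge> 0\<close>])
      (use False bd[of "- s" for s] in auto)
  then show ?thesis using False by simp
qed

text \<open>The difference of two solutions solves the same equation and starts at 0, so the energy
  estimate with zero slack keeps it at 0.\<close>

lemma linear_ode_unique:
  fixes A :: "real \<Rightarrow> 'a::real_inner \<Rightarrow>\<^sub>L 'a"
  assumes "\<And>t. norm (A t) \<le> M"
    and "\<And>t. (y has_vector_derivative A t (y t)) (at t)"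
    and "\<And>t. (z has_vector_derivative A t (z t)) (at t)"
    and "y 0 = z 0"
  shows "y = z"
proof
  fix t
  have M: "M \<ge> 0" using assms(1)[of 0] norm_ge_zero order_trans by blast
  have "((\<lambda>t. y t - z t) has_vector_derivative A t (y t - z t)) (at t)" for t
    using has_vector_derivative_diff[OF assms(2,3)] by (simp add: blinfun.diff_right)
  moreover have "norm (A s (y s - z s)) \<le> M * norm (y s - z s) + 0" for s
    using norm_blinfun[of "A s" "y s - z s"] mult_right_mono[OF assms(1)[of s] norm_ge_zero[of "y s - z s"]]
    by simp
  ultimately have "(norm (y t - z t))\<^sup>2 \<le> exp ((2 * M + 1) * \<bar>t\<bar>) * ((norm (y 0 - z 0))\<^sup>2 + 0\<^sup>2 * \<bar>t\<bar>)"
    using M by (intro norm_gronwall)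
  then show "y t = z t" using assms(4) by simp
qed

section \<open>Cauchy matrices\<close>

lemma bounded_bilinear_matrix_matrix_mult:
  "bounded_bilinear ((**) :: real ^ 'm ^ 'n \<Rightarrow> real ^ 'k ^ 'm \<Rightarrow> real ^ 'k ^ 'n)"
  unfolding bilinear_conv_bounded_bilinear[symmetric] bilinear_def
  by (auto intro!: linearI
      simp: vec_eq_iff matrix_matrix_mult_def sum.distrib sum_distrib_left algebra_simps)

lemma bounded_bilinear_matrix_vector_mult:
  "bounded_bilinear ((*v) :: real ^ 'm ^ 'n \<Rightarrow> real ^ 'm \<Rightarrow> real ^ 'n)"
  unfolding bilinear_conv_bounded_bilinear[symmetric] bilinear_def
  by (auto intro!: linearI simp: algebra_simps matrix_vector_mult_scaleR scaleR_matrix_vector_assoc)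

text \<open>Turns the matrix equation into a linear equation on the Euclidean space of matrices, to
  which the results for \<open>blinfun\<close> coefficients apply.\<close>

definition left_mult :: "(real ^ 'n ^ 'n) \<Rightarrow> ((real ^ 'n ^ 'n) \<Rightarrow>\<^sub>L (real ^ 'n ^ 'n))" where
  "left_mult A = Blinfun ((**) A)"

lemma left_mult_apply [simp]: "blinfun_apply (left_mult A) X = A ** X"
  unfolding left_mult_def
  by (simp add: bounded_linear_Blinfun_apply
      bounded_bilinear.bounded_linear_right[OF bounded_bilinear_matrix_matrix_mult])

lemma bounded_linear_left_mult: "bounded_linear left_mult"
  unfolding linear_conv_bounded_linear[symmetric]
  by (rule linearI; rule blinfun_eqI)
    (simp_all add: blinfun.add_left blinfun.scaleR_left
      bounded_bilinear.add_left[OF bounded_bilinear_matrix_matrix_mult]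
      bounded_bilinear.scaleR_left[OF bounded_bilinear_matrix_matrix_mult])

lemma left_mult_bounded:
  fixes A :: "real \<Rightarrow> real ^ 'n ^ 'n"
  assumes "bounded (range A)"
  obtains M where "M \<ge> 0" "\<And>t. norm (left_mult (A t)) \<le> M"
proof -
  have "bounded ((\<lambda>t. left_mult (A t)) ` UNIV)"
    using bounded_linear_image[OF assms bounded_linear_left_mult] by (simp add: image_image)
  then obtain M where "\<And>t. norm (left_mult (A t)) \<le> M" by (auto simp: bounded_iff)
  then show ?thesis using that[of M] norm_ge_zero order_trans by blast
qed

lemma matrix_ode_unique:
  fixes A \<Phi> \<Psi> :: "real \<Rightarrow> real ^ 'n ^ 'n"
  assumes "bounded (range A)"
    and "\<And>t. (\<Phi> has_vector_derivative A t ** \<Phi> t) (at t)"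
    and "\<And>t. (\<Psi> has_vector_derivative A t ** \<Psi> t) (at t)"
    and "\<Phi> 0 = \<Psi> 0"
  shows "\<Phi> = \<Psi>"
proof -
  obtain M where "\<And>t. norm (left_mult (A t)) \<le> M"
    using left_mult_bounded[OF assms(1)] by metis
  then show ?thesis
    using linear_ode_unique[of "\<lambda>t. left_mult (A t)" M \<Phi> \<Psi>] assms(2-4) by simp
qed

text \<open>The definite description in \<open>cauchy_matrix\<close> denotes a solution only once
  existence and uniqueness are both known; its defining properties are then read off.\<close>

lemma
  fixes A :: "real \<Rightarrow> real ^ 'n ^ 'n"
  assumes cont: "continuous_on UNIV A" and bd: "bounded (range A)"
  shows cauchy_matrix_has_vector_derivative:
      "((\<lambda>s. cauchy_matrix s 0 A) has_vector_derivative A t ** cauchy_matrix t 0 A) (at t)"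
    and cauchy_matrix_initial: "cauchy_matrix 0 0 A = mat 1"
proof -
  let ?P = "\<lambda>\<Phi>. (\<forall>s. (\<Phi> has_vector_derivative A s ** \<Phi> s) (at s)) \<and> \<Phi> 0 = mat 1"
  obtain M where "\<And>t. norm (left_mult (A t)) \<le> M"
    using left_mult_bounded[OF bd] by metis
  moreover have "continuous_on UNIV (\<lambda>t. left_mult (A t))"
    by (rule bounded_linear.continuous_on[OF bounded_linear_left_mult cont])
  ultimately obtain \<Phi> where \<Phi>: "?P \<Phi>"
    using linear_ode_exists[of "\<lambda>t. left_mult (A t)" M "mat 1"] by auto
  have "\<Psi> = \<Phi>" if "?P \<Psi>" for \<Psi>
    using matrix_ode_unique[OF bd, of \<Psi> \<Phi>] that \<Phi> by simp
  then have "?P (THE \<Phi>. ?P \<Phi>)"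
    by (rule theI[of ?P \<Phi>, OF \<Phi>])
  then show "((\<lambda>s. cauchy_matrix s 0 A) has_vector_derivative A t ** cauchy_matrix t 0 A) (at t)"
      "cauchy_matrix 0 0 A = mat 1"
    unfolding cauchy_matrix_def by auto
qed

text \<open>As functions of \<open>s\<close>, both sides solve the equation with coefficient shifted
  by \<open>t\<close> and agree at \<open>s = 0\<close>. This becomes the group law of
  \<open>flow\<close>.\<close>

lemma cauchy_matrix_cocycle:
  fixes A :: "real \<Rightarrow> real ^ 'n ^ 'n"
  assumes cont: "continuous_on UNIV A" and bd: "bounded (range A)"
  shows "cauchy_matrix (s + t) 0 A = cauchy_matrix s 0 (\<lambda>r. A (t + r)) ** cauchy_matrix t 0 A"
proof -
  let ?A = "\<lambda>r. A (t + r)"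
  have cont': "continuous_on UNIV ?A"
    by (rule continuous_on_compose2[OF cont]) (auto intro!: continuous_intros)
  have bd': "bounded (range ?A)" by (rule bounded_subset[OF bd]) auto
  have "((\<lambda>s. cauchy_matrix (s + t) 0 A) has_vector_derivative ?A s ** cauchy_matrix (s + t) 0 A) (at s)"
    for s
  proof -
    have "((\<lambda>s. s + t) has_vector_derivative 1) (at s)" by (auto intro!: derivative_eq_intros)
    from vector_diff_chain_at[OF this cauchy_matrix_has_vector_derivative[OF assms]]
    show ?thesis by (simp add: o_def add.commute)
  qed
  moreover have "((\<lambda>s. cauchy_matrix s 0 ?A ** cauchy_matrix t 0 A) has_vector_derivative
      ?A s ** (cauchy_matrix s 0 ?A ** cauchy_matrix t 0 A)) (at s)" for s
    using bounded_linear.has_vector_derivative[OF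
        bounded_bilinear.bounded_linear_left[OF bounded_bilinear_matrix_matrix_mult]
        cauchy_matrix_has_vector_derivative[OF cont' bd']]
    by (simp add: matrix_mul_assoc)
  ultimately have "(\<lambda>s. cauchy_matrix (s + t) 0 A) = (\<lambda>s. cauchy_matrix s 0 ?A ** cauchy_matrix t 0 A)"
    by (rule matrix_ode_unique[OF bd']) (simp add: cauchy_matrix_initial[OF cont' bd'])
  then show ?thesis by meson
qed

text \<open>The difference \<open>D\<close> of the two Cauchy matrices satisfies
  \<open>D' = A D + (B - A) D + (B - A) \<Phi>\<close> with \<open>D 0 = 0\<close>. The last term is
  the slack in the energy estimate, and \<open>C\<close> depends only on \<open>A\<close> and
  \<open>t\<close>.\<close>

lemma cauchy_matrix_perturbation:
  fixes A :: "real \<Rightarrow> real ^ 'n ^ 'n"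
  assumes contA: "continuous_on UNIV A" and bdA: "bounded (range A)"
  obtains C where "C \<ge> 0"
    "\<And>B \<epsilon>. \<lbrakk>continuous_on UNIV B; bounded (range B); \<epsilon> \<le> 1; \<And>s. norm (B s - A s) \<le> \<epsilon>\<rbrakk>
      \<Longrightarrow> norm (cauchy_matrix t 0 B - cauchy_matrix t 0 A) \<le> C * \<epsilon>"
proof -
  note [continuous_intros] = bounded_linear.continuous_on[OF bounded_linear_left_mult]
  note diff_left = bounded_bilinear.diff_left[OF bounded_bilinear_matrix_matrix_mult]
    and diff_right = bounded_bilinear.diff_right[OF bounded_bilinear_matrix_matrix_mult]
  obtain M where M: "M \<ge> 0" "\<And>s. norm (left_mult (A s)) \<le> M"
    using left_mult_bounded[OF bdA] by metis
  obtain K where K: "K \<ge> 0" "\<And>(X :: real^'n^'n) (Y :: real^'n^'n). norm (X ** Y) \<le> norm X * norm Y * K"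
    using bounded_bilinear.nonneg_bounded[OF bounded_bilinear_matrix_matrix_mult] by blast
  define \<Phi> where "\<Phi> s = cauchy_matrix s 0 A" for s
  have d\<Phi>: "(\<Phi> has_vector_derivative A s ** \<Phi> s) (at s)" for s
    unfolding \<Phi>_def by (rule cauchy_matrix_has_vector_derivative[OF assms])
  have "continuous_on {-\<bar>t\<bar>..\<bar>t\<bar>} \<Phi>"
    by (meson continuous_at_imp_continuous_on d\<Phi> has_vector_derivative_continuous)
  then have "bounded (\<Phi> ` {-\<bar>t\<bar>..\<bar>t\<bar>})"
    by (rule compact_imp_bounded[OF compact_continuous_image]) simp
  then obtain R where R: "R > 0" "\<And>s. \<bar>s\<bar> \<le> \<bar>t\<bar> \<Longrightarrow> norm (\<Phi> s) \<le> R"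
    by (fastforce simp: bounded_pos abs_le_iff)
  \<comment> \<open>Bounds the homogeneous part: \<open>M\<close> comes from \<open>A\<close>, and
    \<open>K\<close> from \<open>B - A\<close>, whose norm is at most 1.\<close>
  define M' where "M' = M + K"
  \<comment> \<open>The square root of the energy bound for initial value 0 and slack
    \<open>\<epsilon> * R * K\<close>, with \<open>\<epsilon>\<close> factored out.\<close>
  define C where "C = sqrt (exp ((2 * M' + 1) * \<bar>t\<bar>) * ((R * K)\<^sup>2 * \<bar>t\<bar>))"
  have C0: "C \<ge> 0" by (simp add: C_def)
  have "norm (cauchy_matrix t 0 B - \<Phi> t) \<le> C * \<epsilon>"
    if B: "continuous_on UNIV B" "bounded (range B)" and \<epsilon>: "\<epsilon> \<le> 1" "\<And>s. norm (B s - A s) \<le> \<epsilon>" for B \<epsilon>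
  proof -
    have "\<epsilon> \<ge> 0" using \<epsilon>(2)[of 0] norm_ge_zero order_trans by blast
    define D where "D s = cauchy_matrix s 0 B - \<Phi> s" for s
    have dD: "(D has_vector_derivative A s ** D s + (B s - A s) ** D s + (B s - A s) ** \<Phi> s) (at s)" for s
      unfolding D_def
      using has_vector_derivative_diff[OF cauchy_matrix_has_vector_derivative[OF B] d\<Phi>]
      by (simp add: diff_left diff_right)
    have "norm (A s ** D s + (B s - A s) ** D s + (B s - A s) ** \<Phi> s) \<le> M' * norm (D s) + \<epsilon> * R * K"
      if "\<bar>s\<bar> \<le> \<bar>t\<bar>" for s
    proof -
      have "norm (A s ** D s) \<le> M * norm (D s)"
        using norm_blinfun[of "left_mult (A s)" "D s"] mult_right_mono[OF M(2)[of s] norm_ge_zero[of "D s"]]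
        by simp
      moreover have "norm ((B s - A s) ** D s) \<le> 1 * norm (D s) * K"
        by (intro order_trans[OF K(2)] mult_right_mono K(1) order_trans[OF \<epsilon>(2) \<epsilon>(1)]) auto
      moreover have "norm ((B s - A s) ** \<Phi> s) \<le> \<epsilon> * R * K"
        by (intro order_trans[OF K(2)] mult_right_mono mult_mono \<epsilon>(2) K(1) R(2) that) (auto simp: \<open>\<epsilon> \<ge> 0\<close>)
      ultimately have "norm (A s ** D s + (B s - A s) ** D s + (B s - A s) ** \<Phi> s)
          \<le> M * norm (D s) + 1 * norm (D s) * K + \<epsilon> * R * K"
        by (intro norm_triangle_mono)
      then show ?thesis by (simp add: M'_def algebra_simps)
    qed
    from norm_gronwall[OF dD _ this, of t]
    have "(norm (D t))\<^sup>2 \<le> exp ((2 * M' + 1) * \<bar>t\<bar>) * ((norm (D 0))\<^sup>2 + (\<epsilon> * R * K)\<^sup>2 * \<bar>t\<bar>)"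
      using M(1) K(1) by (simp add: M'_def)
    also have "\<dots> = (C * \<epsilon>)\<^sup>2"
      by (simp add: D_def \<Phi>_def cauchy_matrix_initial assms B C_def power_mult_distrib)
    finally have "norm (D t) \<le> C * \<epsilon>"
      by (rule power2_le_imp_le) (simp add: C0 \<open>\<epsilon> \<ge> 0\<close>)
    then show ?thesis unfolding D_def .
  qed
  then show ?thesis using that[OF C0] unfolding \<Phi>_def by blast
qed

section \<open>The space of systems\<close>

text \<open>Coefficients are taken from the type of bounded continuous functions, so that its
  supremum metric and completeness can be transported to \<open>M2\<close>.\<close>

definition hill :: "(real \<Rightarrow>\<^sub>C real) \<Rightarrow> real \<Rightarrow> real ^ 2 ^ 2" where
  "hill f = (\<lambda>t. vector [vector [0, 1], vector [f t, 0]])"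

lemma hill_nth [simp]:
  "hill f t $ 1 $ 1 = 0" "hill f t $ 1 $ 2 = 1" "hill f t $ 2 $ 1 = f t" "hill f t $ 2 $ 2 = 0"
  by (simp_all add: hill_def)

lemma M2_eq_range_hill: "M2 = range hill"
proof (intro set_eqI iffI)
  fix A assume "A \<in> M2"
  then obtain a :: "real \<Rightarrow> real" where a: "continuous_on UNIV a" "bounded (range a)"
    and A: "A = (\<lambda>t. vector [vector [0, 1], vector [a t, 0]])"
    unfolding M2_def by blast
  have "apply_bcontfun (Bcontfun a) = a"
    using a by (intro Bcontfun_inverse) (auto simp: bcontfun_def)
  then have "A = hill (Bcontfun a)" by (simp add: A hill_def)
  then show "A \<in> range hill" by simp
next
  fix A assume "A \<in> range hill"
  then obtain f where A: "A = hill f" by blast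
  have "bounded (range (apply_bcontfun f))"
    using apply_bcontfun[of f] by (simp add: bcontfun_def)
  then show "A \<in> M2"
    unfolding M2_def A hill_def using continuous_on_apply_bcontfun by blast
qed

lemma hill_in_M2 [simp]: "hill f \<in> M2" by (simp add: M2_eq_range_hill)

lemma M2_cases:
  assumes "A \<in> M2" obtains f where "A = hill f"
  using assms by (auto simp: M2_eq_range_hill)

lemma norm_hill_diff: "norm (hill f s - hill g t) = \<bar>f s - g t\<bar>"
  by (simp add: norm_vec_def L2_set_def sum_2)

text \<open>The difference matrix has one possibly nonzero entry, in the lower left corner. It
  depends only on the first coordinate of \<open>x\<close>, and the first basis vector attains the
  norm.\<close>

lemma onorm_hill_diff: "onorm (\<lambda>x. (hill f t - hill g t) *v x) = \<bar>f t - g t\<bar>"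
proof (rule antisym)
  have *: "norm ((hill f t - hill g t) *v x) = \<bar>f t - g t\<bar> * \<bar>x $ 1\<bar>" for x
    by (simp add: norm_vec_def L2_set_def sum_2 matrix_vector_mult_def abs_mult)
  show "onorm (\<lambda>x. (hill f t - hill g t) *v x) \<le> \<bar>f t - g t\<bar>"
    unfolding * by (intro onorm_le) (simp add: * mult_left_mono component_le_norm_cart)
  show "\<bar>f t - g t\<bar> \<le> onorm (\<lambda>x. (hill f t - hill g t) *v x)"
    using onorm[OF matrix_vector_mul_bounded_linear, of "hill f t - hill g t" "axis 1 1"]
    by (simp add: *)
qed

lemma sup_dist_hill: "sup_dist (hill f) (hill g) = dist f g"
  by (simp add: sup_dist_def onorm_hill_diff dist_bcontfun.rep_eq dist_real_def)

lemma hill_inject [simp]: "hill f = hill g \<longleftrightarrow> f = g"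
  by (metis dist_eq_0_iff sup_dist_hill)

lemma Metric_space_M2: "Metric_space M2 sup_dist"
proof
  fix A B C
  show "0 \<le> sup_dist A B" "sup_dist A B = sup_dist B A"
  proof (atomize (full), cases "A \<in> M2 \<and> B \<in> M2")
    case True
    then obtain f g where "A = hill f" "B = hill g" by (metis M2_cases)
    then show "0 \<le> sup_dist A B \<and> sup_dist A B = sup_dist B A"
      by (simp add: sup_dist_hill dist_commute)
  next
    case False
    then have "sup_dist A B = 0" "sup_dist B A = 0" by (auto simp: sup_dist_def)
    then show "0 \<le> sup_dist A B \<and> sup_dist A B = sup_dist B A" by simp
  qed
  show "sup_dist A B = 0 \<longleftrightarrow> A = B" if "A \<in> M2" "B \<in> M2"
    using that by (auto elim!: M2_cases simp: sup_dist_hill)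
  show "sup_dist A C \<le> sup_dist A B + sup_dist B C" if "A \<in> M2" "B \<in> M2" "C \<in> M2"
    using that by (auto elim!: M2_cases simp: sup_dist_hill dist_triangle)
qed

interpretation M2: Metric_space M2 sup_dist by (rule Metric_space_M2)

text \<open>A Cauchy sequence is pulled back along the isometry \<open>hill\<close> to the complete
  space of bounded continuous functions.\<close>

lemma M2_mcomplete: "M2.mcomplete"
  unfolding M2.mcomplete_def
proof (intro allI impI)
  fix \<sigma> assume \<sigma>: "M2.MCauchy \<sigma>"
  then have "\<forall>n. \<exists>f. \<sigma> n = hill f"
    unfolding M2.MCauchy_def by (metis M2_cases range_subsetD)
  then obtain f where f: "\<And>n. \<sigma> n = hill (f n)" by metis
  then have "Cauchy f"
    using \<sigma> unfolding M2.MCauchy_def Cauchy_def by (simp add: sup_dist_hill)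
  then obtain l where "f \<longlonglongrightarrow> l" using Cauchy_convergent convergent_def by blast
  then have "limitin M2.mtopology \<sigma> (hill l) sequentially"
    unfolding M2.limit_metric_sequentially lim_sequentially by (simp add: f sup_dist_hill)
  then show "\<exists>A. limitin M2.mtopology \<sigma> A sequentially" by blast
qed

lemma M2_continuous_on: "A \<in> M2 \<Longrightarrow> continuous_on UNIV A"
proof (elim M2_cases)
  fix f assume "A = hill f"
  moreover have "continuous_on UNIV (hill f)"
    unfolding continuous_on_iff
    using continuous_on_apply_bcontfun[of UNIV f]
    by (auto simp: continuous_on_iff dist_norm norm_hill_diff)
  ultimately show ?thesis by simp
qed

lemma M2_bounded: "A \<in> M2 \<Longrightarrow> bounded (range A)"
proof (elim M2_cases)
  fix f assume A: "A = hill f"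
  have "norm (hill f t) \<le> norm (hill 0 0) + norm f" for t
    using norm_triangle_sub[of "hill f t" "hill 0 0"] norm_bounded[of f t]
    by (simp add: norm_hill_diff)
  then show ?thesis unfolding A bounded_iff by blast
qed

lemma shift_in_M2 [simp]: "A \<in> M2 \<Longrightarrow> shift t A \<in> M2"
  unfolding M2_def
proof clarify
  fix a :: "real \<Rightarrow> real" assume a: "continuous_on UNIV a" "bounded (range a)"
  have "continuous_on UNIV (\<lambda>s. a (t + s))"
    by (rule continuous_on_compose2[OF a(1)]) (auto intro!: continuous_intros)
  moreover have "bounded (range (\<lambda>s. a (t + s)))" by (rule bounded_subset[OF a(2)]) auto
  ultimately show "\<exists>b :: real \<Rightarrow> real. continuous_on UNIV b \<and> bounded (range b) \<and>
      shift t (\<lambda>t. vector [vector [0, 1], vector [a t, 0]]) = (\<lambda>t. vector [vector [0, 1], vector [b t, 0]])"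
    unfolding shift_def by blast
qed

lemma shift_shift: "shift s (shift t A) = shift (s + t) A"
  by (simp add: shift_def add_ac)

lemma shift_0 [simp]: "shift 0 A = A" by (simp add: shift_def)

text \<open>A translation permutes the real line, so both suprema run over the same set of
  values.\<close>

lemma sup_dist_shift [simp]:
  assumes "A \<in> M2" "B \<in> M2"
  shows "sup_dist (shift t A) (shift t B) = sup_dist A B"
proof -
  have "range ((\<lambda>s. onorm (\<lambda>x. (A s - B s) *v x)) \<circ> (+) t) = range (\<lambda>s. onorm (\<lambda>x. (A s - B s) *v x))"
    by (simp only: image_comp[symmetric] surj_plus)
  then have "(SUP s. onorm (\<lambda>x. (shift t A s - shift t B s) *v x)) = (SUP s. onorm (\<lambda>x. (A s - B s) *v x))"
    by (simp add: shift_def o_def)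
  then show ?thesis using assms by (simp add: sup_dist_def)
qed

section \<open>Determinant, growth and continuity of the Cauchy matrices over
  \<open>M2\<close>\<close>

lemma det_cauchy_matrix_M2:
  assumes "A \<in> M2"
  shows "det (cauchy_matrix t 0 A) = 1"
proof -
  obtain f where A: "A = hill f" using assms by (rule M2_cases)
  let ?\<Phi> = "\<lambda>t. cauchy_matrix t 0 A"
  note d = cauchy_matrix_has_vector_derivative[OF M2_continuous_on M2_bounded, OF assms assms]
  have dc: "((\<lambda>s. ?\<Phi> s $ i $ j) has_real_derivative (A t ** ?\<Phi> t) $ i $ j) (at t)" for i j t
    unfolding has_real_derivative_iff_has_vector_derivative
    by (rule bounded_linear.has_vector_derivative[OF _ d])
      (intro bounded_linear_compose[OF bounded_linear_vec_nth bounded_linear_vec_nth])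
  \<comment> \<open>Liouville's formula by hand: inserting the equation into the derivative of the 2
    by 2 determinant gives the trace of \<open>A t\<close> times the determinant, and the trace is
    0.\<close>
  have "((\<lambda>s. det (?\<Phi> s)) has_real_derivative 0) (at t)" for t
    unfolding det_2
    by (rule derivative_eq_intros dc refl)+ (simp add: A matrix_matrix_mult_def sum_2)
  then have "det (?\<Phi> t) = det (?\<Phi> 0)" using DERIV_isconst_all by blast
  then show ?thesis
    using cauchy_matrix_initial[OF M2_continuous_on M2_bounded, OF assms assms] by simp
qed

text \<open>
  The distance to \<open>hill 0\<close> is the supremum of the absolute value of the coefficient function, and
  is shift invariant because \<open>hill 0\<close> is fixed by shifts.
\<close>

lemma norm_cauchy_matrix_mult_le:
  assumes "A \<in> M2"
  shows "norm (cauchy_matrix t 0 A *v x) \<le> exp ((2 + sup_dist A (hill 0)) * \<bar>t\<bar>) * norm x"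
proof -
  obtain f where A: "A = hill f" using assms by (rule M2_cases)
  define y where "y t = cauchy_matrix t 0 A *v x" for t
  have d: "(y has_vector_derivative A t *v y t) (at t)" for t
    unfolding y_def matrix_vector_mul_assoc
    by (rule bounded_linear.has_vector_derivative[OF
        bounded_bilinear.bounded_linear_left[OF bounded_bilinear_matrix_vector_mult]
        cauchy_matrix_has_vector_derivative[OF M2_continuous_on M2_bounded, OF assms assms]])
  \<comment> \<open>\<open>A t\<close> sends \<open>v\<close> to the vector with entries
    \<open>v $ 2\<close> and \<open>f t * v $ 1\<close>; the added 0 is the slack of the energy
    estimate.\<close>
  have "norm (A t *v v) \<le> (1 + norm f) * norm v + 0" for t v
  proof -
    have "norm (A t *v v) \<le> \<bar>v $ 2\<bar> + \<bar>f t\<bar> * \<bar>v $ 1\<bar>"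
      using norm_le_l1_cart[of "A t *v v"]
      by (simp add: sum_2 A matrix_vector_mult_def abs_mult)
    also have "\<dots> \<le> norm v + norm f * norm v"
      using norm_bounded[of f t] by (intro add_mono mult_mono component_le_norm_cart) auto
    finally show ?thesis by (simp add: algebra_simps)
  qed
  then have "(norm (y t))\<^sup>2 \<le> exp ((2 * (1 + norm f) + 1) * \<bar>t\<bar>) * ((norm (y 0))\<^sup>2 + 0\<^sup>2 * \<bar>t\<bar>)"
    by (intro norm_gronwall[OF d]) simp_all
  also have "y 0 = x"
    by (simp add: y_def cauchy_matrix_initial[OF M2_continuous_on M2_bounded, OF assms assms])
  \<comment> \<open>The rate \<open>3 + 2 * norm f\<close> is rounded up to twice
    \<open>2 + norm f\<close>, so that the right-hand side becomes a square.\<close>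
  also have "exp ((2 * (1 + norm f) + 1) * \<bar>t\<bar>) \<le> exp (2 * ((2 + norm f) * \<bar>t\<bar>))"
    unfolding exp_le_cancel_iff mult.assoc[symmetric] by (intro mult_right_mono) auto
  finally have "(norm (y t))\<^sup>2 \<le> (exp ((2 + norm f) * \<bar>t\<bar>) * norm x)\<^sup>2"
    by (simp add: power_mult_distrib exp_double mult_right_mono)
  then have "norm (y t) \<le> exp ((2 + norm f) * \<bar>t\<bar>) * norm x"
    by (rule power2_le_imp_le) simp
  then show ?thesis by (simp add: y_def A sup_dist_hill)
qed

lemma continuous_map_cauchy_matrix_M2:
  "continuous_map M2.mtopology euclidean (\<lambda>A. cauchy_matrix t 0 A)"
  unfolding mtopology_is_euclidean[symmetric] M2.metric_continuous_map[OF Met_TC.Metric_space_axioms]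
proof (intro conjI ballI allI impI)
  fix A and e :: real assume A: "A \<in> M2" and "e > 0"
  obtain C where "C \<ge> 0" and C: "\<And>B \<epsilon>. \<lbrakk>continuous_on UNIV B; bounded (range B); \<epsilon> \<le> 1;
      \<And>s. norm (B s - A s) \<le> \<epsilon>\<rbrakk> \<Longrightarrow> norm (cauchy_matrix t 0 B - cauchy_matrix t 0 A) \<le> C * \<epsilon>"
    using cauchy_matrix_perturbation[OF M2_continuous_on M2_bounded, OF A A] by metis
  \<comment> \<open>The cap 1 meets the hypothesis \<open>\<epsilon> \<le> 1\<close> of the
    perturbation bound, and \<open>C + 1\<close> keeps the denominator positive.\<close>
  define \<delta> where "\<delta> = min 1 (e / (C + 1))"
  have "dist (cauchy_matrix t 0 A) (cauchy_matrix t 0 B) < e"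
    if B: "B \<in> M2" "sup_dist A B < \<delta>" for B
  proof -
    obtain f g where fg: "A = hill f" "B = hill g" using A B(1) by (metis M2_cases)
    have "norm (B s - A s) \<le> sup_dist A B" for s
      using dist_bounded[of f s g] by (simp add: fg norm_hill_diff sup_dist_hill dist_real_def abs_minus_commute)
    then have "norm (cauchy_matrix t 0 B - cauchy_matrix t 0 A) \<le> C * sup_dist A B"
      using B by (intro C M2_continuous_on M2_bounded) (auto simp: \<delta>_def)
    also have "\<dots> \<le> (C + 1) * sup_dist A B" by (simp add: algebra_simps)
    also have "\<dots> < e"
      using B(2) \<open>C \<ge> 0\<close> by (simp add: \<delta>_def field_simps)
    finally show ?thesis by (simp add: dist_norm norm_minus_commute)
  qed
  then show "\<exists>\<delta>>0. \<forall>B. B \<in> M2 \<and> sup_dist A B < \<delta> \<longrightarrow>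
      dist (cauchy_matrix t 0 A) (cauchy_matrix t 0 B) < e"
    using \<open>e > 0\<close> \<open>C \<ge> 0\<close> by (intro exI[of _ \<delta>]) (auto simp: \<delta>_def)
qed simp

lemma continuous_map_shift: "continuous_map M2.mtopology M2.mtopology (shift t)"
  unfolding M2.metric_continuous_map[OF Metric_space_M2] by auto

section \<open>Product bundles\<close>

lemma product_bundle_simps [simp]:
  "total_space (product_bundle B d) = prod_topology (Metric_space.mtopology B d) euclidean"
  "proj (product_bundle B d) = fst" "base (product_bundle B d) = B" "bdist (product_bundle B d) = d"
  "fadd (product_bundle B d) (b, x) (c, y) = (b, x + y)"
  "fscale (product_bundle B d) r (b, x) = (b, r *\<^sub>R x)"
  "finner (product_bundle B d) (b, x) (c, y) = x \<bullet> y"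
  "base_top (product_bundle B d) = Metric_space.mtopology B d"
  by (simp_all add: product_bundle_def base_top_def)

lemma fnorm_product_bundle [simp]: "fnorm (product_bundle B d) (b, x) = norm x"
  by (simp add: fnorm_def norm_eq_sqrt_inner)

lemma fminus_product_bundle [simp]: "fminus (product_bundle B d) (b, x) (c, y) = (b, x - y)"
  by (simp add: fminus_def)

context Metric_space
begin

lemma fibre_product_bundle: "b \<in> M \<Longrightarrow> fibre (product_bundle M d) b = {b} \<times> UNIV"
  by (auto simp: fibre_def)

lemma product_bundle_vector_bundle:
  "vector_bundle TYPE('n) (product_bundle M d :: ('a \<times> (real ^ 'n::finite), 'a) vbundle)"
  unfolding vector_bundle_def
proof (intro conjI ballI)
  show "Metric_space (base (product_bundle M d)) (bdist (product_bundle M d))"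
    by (simp add: Metric_space_axioms)
  show "continuous_map (total_space (product_bundle M d :: ('a \<times> (real ^ 'n), 'a) vbundle))
      (base_top (product_bundle M d :: ('a \<times> (real ^ 'n), 'a) vbundle)) (proj (product_bundle M d))"
    by (simp add: continuous_map_fst)
next
  let ?E = "product_bundle M d :: ('a \<times> (real ^ 'n), 'a) vbundle"
  fix b assume b: "b \<in> base ?E"
  \<comment> \<open>The whole base serves as trivialising neighbourhood, and the trivialisation is
    the identity.\<close>
  have "homeomorphic_map
      (subtopology (total_space ?E) {e \<in> topspace (total_space ?E). proj ?E e \<in> M})
      (prod_topology (subtopology (base_top ?E) M) euclidean) (\<lambda>e. (proj ?E e, snd e))"
  proof -
    have "{e \<in> topspace (total_space ?E). proj ?E e \<in> M} = topspace (total_space ?E)" by auto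
    then show ?thesis
      using homeomorphic_map_id[of "total_space ?E" "total_space ?E"]
      by (simp only: subtopology_topspace) (simp add: id_def subtopology_mspace)
  qed
  then show "\<exists>U (\<phi> :: 'a \<times> (real ^ 'n) \<Rightarrow> real ^ 'n). openin (base_top ?E) U \<and> b \<in> U \<and>
        homeomorphic_map
          (subtopology (total_space ?E) {e \<in> topspace (total_space ?E). proj ?E e \<in> U})
          (prod_topology (subtopology (base_top ?E) U) euclidean) (\<lambda>e. (proj ?E e, \<phi> e)) \<and>
        (\<forall>u\<in>U. \<forall>e\<in>fibre ?E u. (\<forall>e'\<in>fibre ?E u. \<phi> (fadd ?E e e') = \<phi> e + \<phi> e') \<and>
           (\<forall>c. \<phi> (fscale ?E c e) = c *\<^sub>R \<phi> e))"
    using b by (intro exI[of _ M] exI[of _ snd]) (simp add: fibre_product_bundle)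
qed (auto simp: fibre_product_bundle)

lemma product_bundle_riemannian_metric:
  "riemannian_metric (product_bundle M d :: ('a \<times> (real ^ 'n::finite), 'a) vbundle)"
proof -
  let ?E = "product_bundle M d :: ('a \<times> (real ^ 'n), 'a) vbundle"
  let ?S = "prod_topology (total_space ?E) (total_space ?E)"
  have "continuous_map ?S (prod_topology euclidean euclidean) (\<lambda>p. (snd (fst p), snd (snd p)))"
    using continuous_map_compose[OF continuous_map_fst continuous_map_snd]
      continuous_map_compose[OF continuous_map_snd continuous_map_snd]
    by (intro continuous_map_pairedI) (simp_all add: o_def)
  moreover have "continuous_map (prod_topology euclidean euclidean) euclideanreal (\<lambda>(x :: real ^ 'n, y). x \<bullet> y)"
    by (simp add: case_prod_unfold) (intro continuous_intros)
  ultimately have "continuous_map ?S euclideanreal ((\<lambda>(x :: real ^ 'n, y). x \<bullet> y) \<circ> (\<lambda>p. (snd (fst p), snd (snd p))))"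
    by (rule continuous_map_compose)
  moreover have "(\<lambda>(x :: real ^ 'n, y). x \<bullet> y) \<circ> (\<lambda>p. (snd (fst p), snd (snd p))) = (\<lambda>(u, v). finner ?E u v)"
    by (auto simp: fun_eq_iff)
  ultimately have "continuous_map ?S euclideanreal (\<lambda>(u, v). finner ?E u v)" by simp
  then have "continuous_map (subtopology ?S {(u, v). proj ?E u = proj ?E v}) euclideanreal
      (\<lambda>(u, v). finner ?E u v)"
    by (rule continuous_map_from_subtopology)
  then show ?thesis
    unfolding riemannian_metric_def
    by (auto simp: fibre_product_bundle inner_commute inner_add_left inner_add_right)
qed

text \<open>The unit ball of the fibre contains the zero vector, so the supremum is taken over a
  nonempty set and any bound on the ball bounds it. All operator norms below are estimated this
  way.\<close>

lemma fonorm_product_bundle_le: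
  assumes "b \<in> M" and "C \<ge> 0"
    and "\<And>x. fnorm (product_bundle M d) (L (b, x)) \<le> C * norm (x :: real ^ 'n::finite)"
  shows "fonorm (product_bundle M d) b L \<le> C"
  unfolding fonorm_def
proof (rule cSUP_least)
  show "{u \<in> fibre (product_bundle M d :: ('a \<times> (real ^ 'n), 'a) vbundle) b.
      fnorm (product_bundle M d) u \<le> 1} \<noteq> {}"
    using assms(1) by (auto simp: fibre_product_bundle intro!: exI[of _ 0])
next
  fix u :: "'a \<times> (real ^ 'n)"
  assume "u \<in> {u \<in> fibre (product_bundle M d) b. fnorm (product_bundle M d) u \<le> 1}"
  then obtain x where u: "u = (b, x)" and x: "norm x \<le> 1"
    using assms(1) by (auto simp: fibre_product_bundle)
  show "fnorm (product_bundle M d) (L u) \<le> C"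
    using assms(3)[of x] mult_left_mono[OF x assms(2)] by (simp add: u)
qed

text \<open>Continuity on the total space rests on the joint continuity of the bilinear map
  \<open>*v\<close>.\<close>

lemma product_bundle_morphism:
  fixes F :: "'a \<Rightarrow> real ^ 'n::finite ^ 'n"
  assumes h: "continuous_map mtopology mtopology h" and F: "continuous_map mtopology euclidean F"
  shows "bundle_morphism (product_bundle M d) (\<lambda>(b, x). (h b, F b *v x)) h"
proof -
  let ?E = "product_bundle M d :: ('a \<times> (real ^ 'n), 'a) vbundle"
  let ?T = "prod_topology mtopology (euclidean :: (real ^ 'n) topology)"
  have "continuous_map ?T (prod_topology euclidean euclidean) (\<lambda>p. (F (fst p), snd p))"
    using continuous_map_compose[OF continuous_map_fst F]
    by (intro continuous_map_pairedI continuous_map_snd) (simp add: o_def)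
  moreover have "continuous_map (prod_topology euclidean euclidean) euclidean
      (\<lambda>(X :: real ^ 'n ^ 'n, y). X *v y)"
    by (simp add: case_prod_unfold)
      (intro bounded_bilinear.continuous_on[OF bounded_bilinear_matrix_vector_mult] continuous_intros)
  ultimately have "continuous_map ?T euclidean ((\<lambda>(X :: real ^ 'n ^ 'n, y). X *v y) \<circ> (\<lambda>p. (F (fst p), snd p)))"
    by (rule continuous_map_compose)
  then have "continuous_map ?T ?T (\<lambda>p. (h (fst p), F (fst p) *v snd p))"
    using continuous_map_compose[OF continuous_map_fst h]
    by (intro continuous_map_pairedI) (simp_all add: o_def)
  moreover have "h b \<in> M" if "b \<in> M" for b
    using continuous_map_image_subset_topspace[OF h] that by auto
  ultimately show ?thesis
    unfolding bundle_morphism_def fibre_linear_def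
    using h by (auto simp: fibre_product_bundle case_prod_unfold matrix_vector_right_distrib matrix_vector_mult_scaleR)
qed

end

lemma product_bundle_fibre_basis:
  fixes d :: "'a \<Rightarrow> 'a \<Rightarrow> real"
  assumes "Metric_space M d" "b \<in> M"
  shows "fibre_basis (product_bundle M d) b (\<lambda>i :: 2. (b, axis i 1 :: real ^ 2))"
proof -
  interpret Metric_space M d by fact
  let ?E = "product_bundle M d :: ('a \<times> (real ^ 2), 'a) vbundle"
  let ?\<xi> = "\<lambda>i :: 2. (b, axis i 1 :: real ^ 2)"
  have fib: "fibre ?E b = {b} \<times> UNIV" by (rule fibre_product_bundle) fact
  have "?\<xi> i \<notin> fspan ?E b (?\<xi> ` (- {i}))" for i
  proof
    assume "?\<xi> i \<in> fspan ?E b (?\<xi> ` (- {i}))"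
    \<comment> \<open>The vectors with vanishing \<open>i\<close>-th coordinate form one of the sets
      intersected in \<open>fspan\<close>, and the other basis vector lies in it.\<close>
    moreover have "fspan ?E b (?\<xi> ` (- {i})) \<subseteq> {b} \<times> {x. x $ i = 0}"
      unfolding fspan_def fib by (rule Inter_lower) (auto simp: axis_def intro!: exI[of _ 0])
    ultimately show False by (auto simp: axis_def)
  qed
  moreover have "fspan ?E b (range ?\<xi>) = fibre ?E b"
  proof
    show "fspan ?E b (range ?\<xi>) \<subseteq> fibre ?E b"
      unfolding fspan_def fib by (rule Inter_lower) auto
    show "fibre ?E b \<subseteq> fspan ?E b (range ?\<xi>)"
      unfolding fspan_def
    proof (intro subsetI InterI, clarify)
      fix c x W
      assume c: "(c, x) \<in> fibre ?E b" and W: "range ?\<xi> \<subseteq> W"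
        "\<forall>u\<in>W. (\<forall>v\<in>W. fadd ?E u v \<in> W) \<and> (\<forall>c. fscale ?E c u \<in> W)"
      have "fscale ?E r (?\<xi> i) \<in> W" for r i using W by blast
      then have "fadd ?E (fscale ?E (x $ 1) (?\<xi> 1)) (fscale ?E (x $ 2) (?\<xi> 2)) \<in> W"
        using W(2) by blast
      moreover have "x $ 1 *\<^sub>R axis 1 1 + x $ 2 *\<^sub>R axis 2 1 = x"
        by (simp add: vec_eq_iff forall_2 axis_def)
      ultimately show "(c, x) \<in> W" using c by (simp add: fib)
    qed
  qed
  ultimately show ?thesis by (auto simp: fibre_basis_def fib)
qed

section \<open>The bundle over the space of systems\<close>

text \<open>
  Gram determinants stand in for determinants of maps between fibres, so that no matrix
  representation of the isometries is needed.
\<close>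

definition gram :: "'a::real_inner \<Rightarrow> 'a \<Rightarrow> real" where
  "gram x y = (x \<bullet> x) * (y \<bullet> y) - (x \<bullet> y)\<^sup>2"

text \<open>The Gram determinant is the squared area of the parallelogram on the two vectors, and a
  linear map scales area by the absolute value of its determinant.\<close>

lemma gram_matrix_vector_mult:
  fixes X :: "real ^ 2 ^ 2"
  shows "gram (X *v x) (X *v y) = (det X)\<^sup>2 * gram x y"
  by (simp add: gram_def inner_vec_def sum_2 det_2 matrix_vector_mult_def power2_eq_square algebra_simps)

lemma gram_scaleR: "gram (c *\<^sub>R x) (c *\<^sub>R y) = c ^ 4 * gram x y"
  by (simp add: gram_def power2_eq_square power4_eq_xxxx algebra_simps)

section \<open>The flow and the standing assumptions on the family\<close>

lemma flow_pair: "flow t (A, x) = (shift t A, cauchy_matrix t 0 A *v x)"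
  by (simp add: flow_def)

lemma flow_flow:
  assumes "A \<in> M2"
  shows "flow s (flow t (A, x)) = flow (s + t) (A, x)"
  using cauchy_matrix_cocycle[OF M2_continuous_on M2_bounded, OF assms assms, of s t]
  by (simp add: flow_pair shift_shift matrix_vector_mul_assoc shift_def[symmetric])

lemma flow_0: "A \<in> M2 \<Longrightarrow> flow 0 (A, x) = (A, x)"
  by (simp add: flow_pair cauchy_matrix_initial M2_continuous_on M2_bounded)

lemma inj_on_shift: "inj_on (shift t) M2"
  by (rule inj_on_inverseI[of _ "shift (- t)"]) (simp add: shift_shift)

lemma inv_into_shift: "A \<in> M2 \<Longrightarrow> inv_into M2 (shift t) A = shift (- t) A"
  by (rule inv_into_f_eq[OF inj_on_shift]) (simp_all add: shift_shift)

lemma int_iterate_shift: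
  assumes "A \<in> M2"
  shows "int_iterate M2 (shift 1) m A = shift (of_int m) A"
proof -
  have "(shift 1 ^^ n) A = shift (real n) A" for n
    by (induction n) (simp_all add: shift_shift)
  moreover have "(inv_into M2 (shift 1) ^^ n) A = shift (- real n) A" for n
    by (induction n) (simp_all add: assms inv_into_shift shift_shift)
  ultimately show ?thesis by (simp add: int_iterate_def)
qed

lemma sup_dist_shift_hill_0 [simp]:
  assumes "A \<in> M2"
  shows "sup_dist (shift t A) (hill 0) = sup_dist A (hill 0)"
proof -
  have "shift t (hill 0) = hill 0" by (simp add: shift_def hill_def)
  then show ?thesis using sup_dist_shift[OF assms hill_in_M2, of t 0] by simp
qed

lemma M2_bundle_flow_morphism: "bundle_morphism M2_bundle (flow t) (shift t)"
  using M2.product_bundle_morphism[OF continuous_map_shift continuous_map_cauchy_matrix_M2, of t t]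
  unfolding M2_bundle_def flow_def .

lemma M2_bundle_simps [simp]:
  "total_space M2_bundle = prod_topology M2.mtopology euclidean" "proj M2_bundle = fst"
  "base M2_bundle = M2" "bdist M2_bundle = sup_dist"
  "fadd M2_bundle (A, x) (B, y) = (A, x + y)" "fscale M2_bundle r (A, x) = (A, r *\<^sub>R x)"
  "finner M2_bundle (A, x) (B, y) = x \<bullet> y"
  "fnorm M2_bundle (A, x) = norm x" "fminus M2_bundle (A, x) (B, y) = (A, x - y)"
  "A \<in> M2 \<Longrightarrow> fibre M2_bundle A = {A} \<times> UNIV"
  by (simp_all add: M2_bundle_def M2.fibre_product_bundle)

lemmas M2_bundle_fonorm_le = M2.fonorm_product_bundle_le[where 'n = 2, folded M2_bundle_def]

text \<open>Identifies the inverse on a fibre with the backward flow, so that its norm is governed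
  by a Cauchy matrix at negative time.\<close>

lemma inv_into_flow:
  assumes "A \<in> M2"
  shows "inv_into ({A} \<times> UNIV) (flow t) (shift t A, x) = flow (- t) (shift t A, x)"
proof (rule inv_into_f_eq)
  show "inj_on (flow t) ({A} \<times> UNIV)"
    by (rule inj_on_inverseI[of _ "flow (- t)"]) (use assms in \<open>auto simp: flow_flow flow_0\<close>)
  show "flow (- t) (shift t A, x) \<in> {A} \<times> UNIV" by (simp add: flow_pair shift_shift)
  show "flow t (flow (- t) (shift t A, x)) = (shift t A, x)" by (simp add: assms flow_flow flow_0)
qed

lemma M2_morphism_family: "morphism_family M2_bundle (\<lambda>m. flow (real m)) (\<lambda>m. shift (real m))"
  unfolding morphism_family_def
proof (intro conjI allI)
  show "bundle_morphism M2_bundle (flow (real m)) (shift (real m))" for m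
    by (rule M2_bundle_flow_morphism)
  have "bundle_isomorphism M2_bundle (flow 1) (shift 1)"
    unfolding bundle_isomorphism_def
    by (intro conjI exI[of _ "flow (-1)"] exI[of _ "shift (-1)"] M2_bundle_flow_morphism)
      (auto simp: flow_flow flow_0 shift_shift)
  then show "bundle_isomorphism M2_bundle (flow (real 1)) (shift (real 1))" by simp
  show "\<forall>e\<in>topspace (total_space M2_bundle). flow (real m) e = (flow (real 1) ^^ m) e" for m
  proof clarsimp
    fix A x assume "A \<in> M2"
    then show "flow (real m) (A, x) = (flow 1 ^^ m) (A, x)"
    proof (induction m)
      case (Suc m)
      then show ?case by (simp add: flow_flow Suc(1)[symmetric])
    qed (simp add: flow_0)
  qed
  show "\<forall>b\<in>base M2_bundle. shift (real m) b = (shift (real 1) ^^ m) b" for m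
    using int_iterate_shift[of _ "int m"] by (simp add: int_iterate_def)
  have "fonorm M2_bundle A (flow 1) \<le> exp (2 + sup_dist A (hill 0))" if "A \<in> M2" for A
    by (rule M2_bundle_fonorm_le[OF that]) (use norm_cauchy_matrix_mult_le[OF that, of 1] in \<open>simp_all add: flow_pair\<close>)
  \<comment> \<open>The growth bound at time -1, starting from \<open>shift 1 A\<close>, has the
    same rate as for \<open>A\<close> because the distance to \<open>hill 0\<close> is shift
    invariant.\<close>
  moreover have "fonorm M2_bundle (shift 1 A) (inv_into (fibre M2_bundle A) (flow 1))
      \<le> exp (2 + sup_dist A (hill 0))" if "A \<in> M2" for A
    by (rule M2_bundle_fonorm_le)
      (use that norm_cauchy_matrix_mult_le[of "shift 1 A" "- 1"] in \<open>simp_all add: inv_into_flow\<close>, simp add: flow_pair)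
  ultimately show "\<exists>a. \<forall>b\<in>base M2_bundle. a b > 0 \<and>
      (\<forall>m. a (int_iterate (base M2_bundle) (shift (real 1)) m b) = a b) \<and>
      max (fonorm M2_bundle b (flow (real 1)))
        (fonorm M2_bundle (shift (real 1) b) (inv_into (fibre M2_bundle b) (flow (real 1)))) \<le> exp (a b)"
    \<comment> \<open>The rate of the growth bound serves as the function \<open>a\<close>: it is
      positive and constant along orbits.\<close>
    by (intro exI[of _ "\<lambda>A. 2 + sup_dist A (hill 0)"])
      (auto simp: int_iterate_shift add_pos_nonneg)
qed

section \<open>Failure of saturation\<close>

lemma M2_aperiodic:
  obtains A where "A \<in> M2" "\<And>m. m \<noteq> 0 \<Longrightarrow> int_iterate M2 (shift 1) m A \<noteq> A"
proof
  have "\<bar>arctan t\<bar> \<le> pi" for t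
    using arctan_bounded[of t] pi_gt_zero by linarith
  then have "arctan \<in> bcontfun"
    by (intro bcontfun_normI[of _ pi]) (auto intro!: continuous_intros)
  then have f: "apply_bcontfun (Bcontfun arctan) = arctan" by (rule Bcontfun_inverse)
  let ?A = "hill (Bcontfun arctan)"
  show "?A \<in> M2" by simp
  fix m :: int assume "m \<noteq> 0"
  \<comment> \<open>The lower left entries at time 0 are \<open>arctan\<close> of \<open>m\<close>
    and of 0, which differ because \<open>arctan\<close> is injective.\<close>
  have "shift (of_int m) ?A 0 $ 2 $ 1 \<noteq> ?A 0 $ 2 $ 1"
    using \<open>m \<noteq> 0\<close> by (simp add: shift_def f)
  then show "int_iterate M2 (shift 1) m ?A \<noteq> ?A"
    by (metis int_iterate_shift hill_in_M2)
qed

lemma fscale_M2_bundle: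
  "flow t (fscale M2_bundle c e) = fscale M2_bundle c (flow t e)"
  "fscale M2_bundle c (fscale M2_bundle c' e) = fscale M2_bundle (c * c') e"
  "fscale M2_bundle 1 e = e"
  by (cases e; simp add: flow_pair matrix_vector_mult_scaleR)+

text \<open>Makes the scaled flow admissible as an operator \<open>Y\<close>; its inverse is the
  backward flow scaled by \<open>1 / c\<close>.\<close>

lemma scaled_flow_fibre_iso:
  assumes A: "A \<in> M2" and "c \<noteq> 0"
  shows "fibre_iso M2_bundle A (shift t A) (\<lambda>e. fscale M2_bundle c (flow t e))"
  unfolding fibre_iso_def fibre_linear_def
proof (intro conjI)
  show "bij_betw (\<lambda>e. fscale M2_bundle c (flow t e)) (fibre M2_bundle A) (fibre M2_bundle (shift t A))"
  proof (rule bij_betwI[where g = "\<lambda>e. fscale M2_bundle (1 / c) (flow (- t) e)"])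
    show "(\<lambda>e. fscale M2_bundle c (flow t e)) \<in> fibre M2_bundle A \<rightarrow> fibre M2_bundle (shift t A)"
      "(\<lambda>e. fscale M2_bundle (1 / c) (flow (- t) e)) \<in> fibre M2_bundle (shift t A) \<rightarrow> fibre M2_bundle A"
      using A by (auto simp: flow_pair shift_shift)
    show "fscale M2_bundle (1 / c) (flow (- t) (fscale M2_bundle c (flow t e))) = e"
      if "e \<in> fibre M2_bundle A" for e
      using that assms by (auto simp: fscale_M2_bundle flow_flow flow_0)
    show "fscale M2_bundle c (flow t (fscale M2_bundle (1 / c) (flow (- t) e))) = e"
      if "e \<in> fibre M2_bundle (shift t A)" for e
      using that assms by (auto simp: fscale_M2_bundle flow_flow flow_0)
  qed
qed (use A in \<open>auto simp: flow_pair matrix_vector_right_distrib matrix_vector_mult_scaleR scaleR_add_right\<close>)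

text \<open>Gram determinants are built from inner products alone, so an isometry preserves them.
  The pair equations give access to the vector parts of the images.\<close>

lemma fibre_isometry_gram:
  assumes "fibre_isometry M2_bundle A B L" "A \<in> M2" "B \<in> M2"
    and "L (A, x) = (B', x')" "L (A, y) = (B'', y')"
  shows "B' = B" "B'' = B" "gram x' y' = gram x y"
proof -
  have L: "L ` ({A} \<times> UNIV) \<subseteq> {B} \<times> UNIV"
    and i: "\<And>x y. finner M2_bundle (L (A, x)) (L (A, y)) = x \<bullet> y"
    using assms(1-3) by (auto simp: fibre_isometry_def fibre_iso_def fibre_linear_def)
  have "L (A, x) \<in> {B} \<times> UNIV" "L (A, y) \<in> {B} \<times> UNIV" using L by blast+
  then show "B' = B" "B'' = B" by (simp_all add: assms(4,5))
  show "gram x' y' = gram x y"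
    using i[of x x] i[of y y] i[of x y] by (simp add: gram_def assms(4,5))
qed

text \<open>If the two sides agreed everywhere, the Gram determinant of the standard basis could be
  computed along both. The isometries and the Cauchy matrices of determinant 1 preserve it, while
  the scaling multiplies it by \<open>(1 + \<eta>) ^ 4\<close>.\<close>

lemma no_conjugating_isometries:
  assumes "A \<in> M2" "B \<in> M2" "\<eta> > 0"
    and iso0: "fibre_isometry M2_bundle B A \<psi>\<^sub>0"
    and iso1: "fibre_isometry M2_bundle (shift t B) (shift t A) \<psi>\<^sub>1"
  shows "\<exists>e\<in>fibre M2_bundle B. \<psi>\<^sub>1 (flow t e) \<noteq> fscale M2_bundle (1 + \<eta>) (flow t (\<psi>\<^sub>0 e))"
proof (rule ccontr)
  let ?x = "axis 1 1 :: real ^ 2" and ?y = "axis 2 1 :: real ^ 2"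
  assume "\<not> ?thesis"
  then have eq: "\<psi>\<^sub>1 (flow t (B, z)) = fscale M2_bundle (1 + \<eta>) (flow t (\<psi>\<^sub>0 (B, z)))" for z
    using assms(2) by auto
  obtain A' x' A'' y' where p: "\<psi>\<^sub>0 (B, ?x) = (A', x')" "\<psi>\<^sub>0 (B, ?y) = (A'', y')"
    by fastforce
  note g0 = fibre_isometry_gram[OF iso0 assms(2,1) p]
  have p1: "\<psi>\<^sub>1 (shift t B, cauchy_matrix t 0 B *v ?x) = (shift t A, (1 + \<eta>) *\<^sub>R (cauchy_matrix t 0 A *v x'))"
    "\<psi>\<^sub>1 (shift t B, cauchy_matrix t 0 B *v ?y) = (shift t A, (1 + \<eta>) *\<^sub>R (cauchy_matrix t 0 A *v y'))"
    using eq[of ?x] eq[of ?y] by (simp_all add: p g0 flow_pair)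
  have "gram ?x ?y = (1 + \<eta>) ^ 4 * gram x' y'"
    using fibre_isometry_gram(3)[OF iso1 _ _ p1] assms(1,2)
    by (simp add: gram_scaleR gram_matrix_vector_mult det_cauchy_matrix_M2)
  then have "1 = (1 + \<eta>) ^ 4"
    using g0(3) by (simp add: gram_def inner_axis_axis)
  moreover have "(1 + \<eta>) ^ 4 > 1" using \<open>\<eta> > 0\<close> by (intro one_less_power) auto
  ultimately show False by simp
qed

text \<open>Saturation at horizon \<open>T = 1\<close>, with \<open>\<epsilon> = 1\<close> and
  \<open>UNIV\<close> as each neighbourhood. Since \<open>\<epsilon>\<close> and the neighbourhoods
  are chosen before \<open>\<delta>\<close>, the same \<open>\<delta>\<close> works for every
  \<open>Y\<close>.\<close>

lemma saturated_one_step: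
  fixes \<xi> :: "'n::finite \<Rightarrow> 'e"
  assumes sat: "saturated TYPE('n) \<eta> X h" and b: "b \<in> base \<eta>"
    and ap: "\<forall>m. m \<noteq> 0 \<longrightarrow> int_iterate (base \<eta>) (h 1) m b \<noteq> b" and \<xi>: "fibre_basis \<eta> b \<xi>"
  shows "\<exists>\<delta>>0. \<forall>Y. fibre_iso \<eta> (h 0 b) (h 1 b) Y \<and>
      fonorm \<eta> (h 1 b) (\<lambda>v. fminus \<eta> (Y (inv_into (fibre \<eta> (h 0 b)) (X 1) v)) v) +
      fonorm \<eta> (h 1 b) (\<lambda>v. fminus \<eta> (X 1 (inv_into (fibre \<eta> (h 0 b)) Y v)) v) < \<delta> \<longrightarrow>
      (\<exists>b'\<in>base \<eta>. \<exists>\<psi>\<^sub>0 \<psi>\<^sub>1. fibre_isometry \<eta> (h 0 b') (h 0 b) \<psi>\<^sub>0 \<and>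
        fibre_isometry \<eta> (h 1 b') (h 1 b) \<psi>\<^sub>1 \<and>
        (\<forall>e\<in>fibre \<eta> (h 0 b'). \<psi>\<^sub>1 (X 1 e) = Y (\<psi>\<^sub>0 e)))"
proof -
  have "\<xi> i \<in> topspace (total_space \<eta>)" for i
    using \<xi> by (auto simp: fibre_basis_def fibre_def)
  \<comment> \<open>\<open>UNIV\<close> counts as a neighbourhood because the carrier of the total
    space is open and contains each \<open>\<xi> i\<close>.\<close>
  then have U: "\<exists>V. openin (total_space \<eta>) V \<and> \<xi> i \<in> V \<and> V \<subseteq> UNIV" for i
    using openin_topspace by blast
  show ?thesis
    using sat[unfolded saturated_def, THEN bspec, OF b, THEN mp, OF ap, rule_format, OF zero_less_one \<xi> U]
    apply (elim ex_forward conj_forward)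
    subgoal .
    subgoal premises \<delta> for \<delta>
    proof (intro allI impI)
      fix Y
      assume Y: "fibre_iso \<eta> (h 0 b) (h 1 b) Y \<and>
        fonorm \<eta> (h 1 b) (\<lambda>v. fminus \<eta> (Y (inv_into (fibre \<eta> (h 0 b)) (X 1) v)) v) +
        fonorm \<eta> (h 1 b) (\<lambda>v. fminus \<eta> (X 1 (inv_into (fibre \<eta> (h 0 b)) Y v)) v) < \<delta>"
      show "\<exists>b'\<in>base \<eta>. \<exists>\<psi>\<^sub>0 \<psi>\<^sub>1. fibre_isometry \<eta> (h 0 b') (h 0 b) \<psi>\<^sub>0 \<and>
          fibre_isometry \<eta> (h 1 b') (h 1 b) \<psi>\<^sub>1 \<and>
          (\<forall>e\<in>fibre \<eta> (h 0 b'). \<psi>\<^sub>1 (X 1 e) = Y (\<psi>\<^sub>0 e))"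
        using \<delta>[THEN spec, of 1, THEN spec, of "\<lambda>_. Y"] Y by force
    qed
    done
qed

lemma M2_not_saturated: "\<not> saturated TYPE(2) M2_bundle (\<lambda>m. flow (real m)) (\<lambda>m. shift (real m))"
proof
  assume sat: "saturated TYPE(2) M2_bundle (\<lambda>m. flow (real m)) (\<lambda>m. shift (real m))"
  obtain A where A: "A \<in> M2" and ap: "\<And>m. m \<noteq> 0 \<Longrightarrow> int_iterate M2 (shift 1) m A \<noteq> A"
    using M2_aperiodic by metis
  have "fibre_basis M2_bundle A (\<lambda>i :: 2. (A, axis i 1))"
    using product_bundle_fibre_basis[OF Metric_space_M2 A] by (simp add: M2_bundle_def)
  from saturated_one_step[OF sat _ _ this] A ap
  obtain \<delta> where "\<delta> > 0" and \<delta>: "\<And>Y. fibre_iso M2_bundle A (shift 1 A) Y \<Longrightarrow>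
      fonorm M2_bundle (shift 1 A) (\<lambda>v. fminus M2_bundle (Y (inv_into ({A} \<times> UNIV) (flow 1) v)) v) +
      fonorm M2_bundle (shift 1 A) (\<lambda>v. fminus M2_bundle (flow 1 (inv_into ({A} \<times> UNIV) Y v)) v) < \<delta> \<Longrightarrow>
      \<exists>B\<in>M2. \<exists>\<psi>\<^sub>0 \<psi>\<^sub>1. fibre_isometry M2_bundle B A \<psi>\<^sub>0 \<and>
        fibre_isometry M2_bundle (shift 1 B) (shift 1 A) \<psi>\<^sub>1 \<and>
        (\<forall>e\<in>fibre M2_bundle B. \<psi>\<^sub>1 (flow 1 e) = Y (\<psi>\<^sub>0 e))"
    by auto
  \<comment> \<open>Each of the two operator norms will be at most \<open>\<eta>\<close>, so their
    sum stays below \<open>\<delta>\<close>.\<close>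
  define \<eta> where "\<eta> = \<delta> / 3"
  have \<eta>: "\<eta> > 0" "2 * \<eta> < \<delta>" using \<open>\<delta> > 0\<close> by (simp_all add: \<eta>_def)
  let ?Y = "\<lambda>e. fscale M2_bundle (1 + \<eta>) (flow 1 e)"
  have iso: "fibre_iso M2_bundle A (shift 1 A) ?Y"
    using A \<eta> by (intro scaled_flow_fibre_iso) auto
  \<comment> \<open>Here \<open>Y X^(-1) - I\<close> is exactly \<open>\<eta>\<close> times the
    identity.\<close>
  have "fonorm M2_bundle (shift 1 A) (\<lambda>v. fminus M2_bundle (?Y (inv_into ({A} \<times> UNIV) (flow 1) v)) v) \<le> \<eta>"
  proof (rule M2_bundle_fonorm_le)
    fix x
    have "flow 1 (inv_into ({A} \<times> UNIV) (flow 1) (shift 1 A, x)) = (shift 1 A, x)"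
      using A by (simp add: inv_into_flow flow_flow flow_0)
    then show "fnorm M2_bundle (fminus M2_bundle (?Y (inv_into ({A} \<times> UNIV) (flow 1) (shift 1 A, x))) (shift 1 A, x))
        \<le> \<eta> * norm x"
      using \<eta> by (simp add: scaleR_add_left)
  qed (use A \<eta> in auto)
  \<comment> \<open>Here \<open>X Y^(-1) - I\<close> is \<open>- \<eta> / (1 + \<eta>)\<close> times
    the identity. The inverse of \<open>?Y\<close> is accessed through the preimage \<open>u\<close>
    of a given vector.\<close>
  moreover have "fonorm M2_bundle (shift 1 A) (\<lambda>v. fminus M2_bundle (flow 1 (inv_into ({A} \<times> UNIV) ?Y v)) v) \<le> \<eta>"
  proof (rule M2_bundle_fonorm_le)
    fix x
    define u where "u = inv_into ({A} \<times> UNIV) ?Y (shift 1 A, x)"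
    have im: "(shift 1 A, x) \<in> ?Y ` ({A} \<times> UNIV)"
      using iso A by (simp add: fibre_iso_def bij_betw_def)
    have "u \<in> {A} \<times> UNIV" unfolding u_def by (rule inv_into_into[OF im])
    then obtain z where u: "u = (A, z)" by auto
    have "?Y u = (shift 1 A, x)" unfolding u_def by (rule f_inv_into_f[OF im])
    then have x: "x = (1 + \<eta>) *\<^sub>R (cauchy_matrix 1 0 A *v z)" by (simp add: u flow_pair)
    have "norm x = (1 + \<eta>) * norm (cauchy_matrix 1 0 A *v z)"
      using \<eta> by (simp add: x)
    then have le: "norm (cauchy_matrix 1 0 A *v z) \<le> norm x"
      using \<eta> by (simp add: algebra_simps)
    have "norm (cauchy_matrix 1 0 A *v z - x) = \<eta> * norm (cauchy_matrix 1 0 A *v z)"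
      using \<eta> by (simp add: x scaleR_add_left)
    also have "\<dots> \<le> \<eta> * norm x"
      using \<eta> le by (intro mult_left_mono) simp_all
    finally show "fnorm M2_bundle (fminus M2_bundle (flow 1 (inv_into ({A} \<times> UNIV) ?Y (shift 1 A, x))) (shift 1 A, x))
        \<le> \<eta> * norm x"
      unfolding u_def[symmetric] by (simp add: u flow_pair)
  qed (use A \<eta> in auto)
  ultimately show False
    using \<delta>[OF iso] no_conjugating_isometries[OF A _ \<eta>(1)] \<eta>(2) by fastforce
qed

text \<open>Saturation is a notion for families meeting the standing assumptions, so the bundle, its
  metric, completeness and the morphism family are established together with its failure.\<close>

theorem lemma2:
  "vector_bundle TYPE(2) M2_bundle \<and> riemannian_metric M2_bundle \<and>
   Metric_space.mcomplete (base M2_bundle) (bdist M2_bundle) \<and>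
   morphism_family M2_bundle (\<lambda>m. flow (real m)) (\<lambda>m. shift (real m)) \<and>
   \<not> saturated TYPE(2) M2_bundle (\<lambda>m. flow (real m)) (\<lambda>m. shift (real m))"
  using M2.product_bundle_vector_bundle M2.product_bundle_riemannian_metric M2_mcomplete
    M2_morphism_family M2_not_saturated
  by (simp add: M2_bundle_def)

end
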